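(* Let $J_1$ and $J_2$ be open intervals in $\mathbb{R}$ and let $f\in C^m(J_1\times J_2,\mathbb{R})$, with induced matrix function $F$. Let $(S,T)=(S(t),T(t))$ be a $C^m$ curve in $CS^2_n$ defined on an interval $I$ with joint eigenvalues in $J_1\times J_2$. Then for all $l\in\mathbb{N}$ with $1\le l\le m$, $\frac{d^l}{dt^l}F(S,T)|_{t=t^*}$ is continuous as a function of $t^*$ on $I$.
   Context: $CS^2_n$ is the set of pairs $(S,T)$ of commuting $n\times n$ self-adjoint (complex Hermitian) matrices; a curve in it is $C^m$ if it is $m$-times continuously differentiable as a map into pairs of self-adjoint matrices. If $U$ is unitary with $S=U\operatorname{diag}(x_1,\dots,x_n)U^*$ and $T=U\operatorname{diag}(y_1,\dots,y_n)U^*$, the joint eigenvalues of $(S,T)$ are $(x_i,y_i)$, $1\le i\le n$, and the matrix function induced by $f$ is $F(S,T):=U\operatorname{diag}(f(x_1,y_1),\dots,f(x_n,y_n))U^*$. *)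

theory Defs
  imports "HOL-Analysis.Analysis"
begin

section \<open>Commuting self-adjoint pairs and their matrix functions\<close>

definition conj_transpose :: "complex^'n^'n \<Rightarrow> complex^'n^'n" where
  "conj_transpose A = (\<chi> i j. cnj (A $ j $ i))"

definition self_adjoint :: "complex^'n^'n \<Rightarrow> bool" where
  "self_adjoint A \<longleftrightarrow> conj_transpose A = A"

definition unitary :: "complex^'n^'n \<Rightarrow> bool" where
  "unitary U \<longleftrightarrow> U ** conj_transpose U = mat 1 \<and> conj_transpose U ** U = mat 1"

definition diag_matrix :: "('n \<Rightarrow> real) \<Rightarrow> complex^'n^'n" where
  "diag_matrix d = (\<chi> i j. if i = j then complex_of_real (d i) else 0)"

definition CS2 :: "((complex^'n^'n) \<times> (complex^'n^'n)) set" where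
  "CS2 = {(S, T). self_adjoint S \<and> self_adjoint T \<and> S ** T = T ** S}"

definition joint_diagonalization ::
  "complex^'n^'n \<Rightarrow> ('n \<Rightarrow> real) \<Rightarrow> ('n \<Rightarrow> real) \<Rightarrow> complex^'n^'n \<Rightarrow> complex^'n^'n \<Rightarrow> bool" where
  "joint_diagonalization U x y S T \<longleftrightarrow> unitary U \<and>
     S = U ** diag_matrix x ** conj_transpose U \<and>
     T = U ** diag_matrix y ** conj_transpose U"

definition joint_eigenvalues :: "complex^'n^'n \<Rightarrow> complex^'n^'n \<Rightarrow> (real \<times> real) set" where
  "joint_eigenvalues S T = {(x i, y i) | U x y i. joint_diagonalization U x y S T}"

text \<open>The value does not depend on the joint diagonalization used, see
  \<open>matrix_function_eq\<close> below, so the definite description is legitimate.\<close>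

definition matrix_function ::
  "(real \<times> real \<Rightarrow> real) \<Rightarrow> complex^'n^'n \<Rightarrow> complex^'n^'n \<Rightarrow> complex^'n^'n" where
  "matrix_function f S T = (THE A. \<exists>U x y. joint_diagonalization U x y S T \<and>
     A = U ** diag_matrix (\<lambda>i. f (x i, y i)) ** conj_transpose U)"

lemma matrix_mult_diag_right: "(W ** diag_matrix d) $ i $ j = W $ i $ j * of_real (d j)"
  by (simp add: matrix_matrix_mult_def diag_matrix_def if_distrib if_distribR sum.delta cong: if_cong)

lemma matrix_mult_diag_left: "(diag_matrix d ** W) $ i $ j = of_real (d i) * W $ i $ j"
  by (simp add: matrix_matrix_mult_def diag_matrix_def if_distrib if_distribR sum.delta cong: if_cong)

lemma unitary_conj_eq_iff:
  assumes "unitary U" "unitary V"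
  shows "U ** A ** conj_transpose U = V ** B ** conj_transpose V \<longleftrightarrow>
    (conj_transpose V ** U) ** A = B ** (conj_transpose V ** U)" (is "?l \<longleftrightarrow> ?r")
proof
  assume ?l
  then have "conj_transpose V ** (U ** A ** conj_transpose U) ** U
    = conj_transpose V ** (V ** B ** conj_transpose V) ** U" by simp
  then have "(conj_transpose V ** U) ** A ** (conj_transpose U ** U)
    = (conj_transpose V ** V) ** B ** (conj_transpose V ** U)"
    by (simp only: matrix_mul_assoc)
  then show ?r using assms by (simp add: unitary_def)
next
  assume ?r
  then have "V ** ((conj_transpose V ** U) ** A) ** conj_transpose U
    = V ** (B ** (conj_transpose V ** U)) ** conj_transpose U" by simp
  then have "(V ** conj_transpose V) ** (U ** A ** conj_transpose U)
    = (V ** B ** conj_transpose V) ** (U ** conj_transpose U)"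
    by (simp only: matrix_mul_assoc)
  then show ?l using assms by (simp add: unitary_def)
qed

lemma matrix_function_eq:
  assumes "joint_diagonalization U x y S T"
  shows "matrix_function f S T = U ** diag_matrix (\<lambda>i. f (x i, y i)) ** conj_transpose U"
  unfolding matrix_function_def
proof (rule the_equality)
  show "\<exists>U' x' y'. joint_diagonalization U' x' y' S T \<and>
      U ** diag_matrix (\<lambda>i. f (x i, y i)) ** conj_transpose U
    = U' ** diag_matrix (\<lambda>i. f (x' i, y' i)) ** conj_transpose U'"
    using assms by blast
next
  fix A
  assume "\<exists>V x' y'. joint_diagonalization V x' y' S T \<and>
    A = V ** diag_matrix (\<lambda>i. f (x' i, y' i)) ** conj_transpose V"
  then obtain V x' y' where V: "joint_diagonalization V x' y' S T"
    and A: "A = V ** diag_matrix (\<lambda>i. f (x' i, y' i)) ** conj_transpose V" by blast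
  define W where "W = conj_transpose V ** U"
  have u: "unitary U" "unitary V" using assms V by (auto simp: joint_diagonalization_def)
  have "W ** diag_matrix x = diag_matrix x' ** W" "W ** diag_matrix y = diag_matrix y' ** W"
    unfolding W_def using assms V
    by (auto simp: joint_diagonalization_def simp flip: unitary_conj_eq_iff[OF u])
  then have "W $ i $ j * of_real (x j) = of_real (x' i) * W $ i $ j"
    and "W $ i $ j * of_real (y j) = of_real (y' i) * W $ i $ j" for i j
    by (metis matrix_mult_diag_left matrix_mult_diag_right)+
  then have "W $ i $ j = 0 \<or> (x j = x' i \<and> y j = y' i)" for i j
    by (metis mult.commute mult_cancel_left of_real_eq_iff)
  then have "W ** diag_matrix (\<lambda>i. f (x i, y i)) = diag_matrix (\<lambda>i. f (x' i, y' i)) ** W"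
    unfolding vec_eq_iff matrix_mult_diag_left matrix_mult_diag_right
    by (metis mult.commute mult_zero_left)
  then show "A = U ** diag_matrix (\<lambda>i. f (x i, y i)) ** conj_transpose U"
    using unitary_conj_eq_iff[OF u] A unfolding W_def by metis
qed

section \<open>Functions of class \<open>C\<^sup>m\<close>\<close>

text \<open>Real functions of two variables on an open set \<open>D\<close>: all partial derivatives of order at
  most \<open>m\<close> exist and are continuous on \<open>D\<close>. The functions \<open>f1\<close> and \<open>f2\<close> are the two first-order
  partial derivatives; they are determined on \<open>D\<close>, and their values elsewhere are irrelevant.\<close>

primrec C_two_vars_on :: "nat \<Rightarrow> (real \<times> real) set \<Rightarrow> (real \<times> real \<Rightarrow> real) \<Rightarrow> bool" where
  "C_two_vars_on 0 D f \<longleftrightarrow> continuous_on D f"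
| "C_two_vars_on (Suc m) D f \<longleftrightarrow> continuous_on D f \<and>
     (\<exists>f1 f2.
       (\<forall>(x, y)\<in>D. ((\<lambda>s. f (s, y)) has_real_derivative f1 (x, y)) (at x)) \<and>
       (\<forall>(x, y)\<in>D. ((\<lambda>s. f (x, s)) has_real_derivative f2 (x, y)) (at y)) \<and>
       C_two_vars_on m D f1 \<and> C_two_vars_on m D f2)"

text \<open>Curves on an interval \<open>I\<close>: derivatives are taken within \<open>I\<close>, i.e. they are the usual
  two-sided derivatives at interior points and one-sided at endpoints belonging to \<open>I\<close>.
  Since \<open>vector_derivative\<close> is total, existence is expressed separately by
  \<open>times_differentiable_on\<close>.\<close>

primrec nth_derivative :: "nat \<Rightarrow> (real \<Rightarrow> 'a::real_normed_vector) \<Rightarrow> real set \<Rightarrow> real \<Rightarrow> 'a" where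
  "nth_derivative 0 g I = g"
| "nth_derivative (Suc l) g I = (\<lambda>t. vector_derivative (nth_derivative l g I) (at t within I))"

definition times_differentiable_on ::
  "nat \<Rightarrow> (real \<Rightarrow> 'a::real_normed_vector) \<Rightarrow> real set \<Rightarrow> bool" where
  "times_differentiable_on l g I \<longleftrightarrow> (\<forall>k<l. nth_derivative k g I differentiable_on I)"

definition C_curve_on :: "nat \<Rightarrow> (real \<Rightarrow> 'a::real_normed_vector) \<Rightarrow> real set \<Rightarrow> bool" where
  "C_curve_on m g I \<longleftrightarrow>
     times_differentiable_on m g I \<and> (\<forall>l\<le>m. continuous_on I (nth_derivative l g I))"

end

theory Submission
  imports Defs
begin

text \<open>Let \<open>P\<^sub>i\<close> be the rank-one projections onto an orthonormal basis of joint eigenvectors of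
  \<open>(S, T)\<close> at time \<open>t\<close>.  They may jump with \<open>t\<close> where eigenvalues cross, so \<open>F(S, T)\<close> cannot be
  differentiated through them.  The proof instead finds a class of matrix curves that contains
  \<open>F(S, T)\<close> and that is closed under differentiation, with a loss of one order of smoothness
  each time.

  Because \<open>f\<close> is defined on a rectangle, \<open>F(S, T) = \<Sum>i j. f (x\<^sub>i, y\<^sub>j) P\<^sub>i P\<^sub>j\<close>: the terms with
  \<open>i \<noteq> j\<close> vanish.  This separates the roles of \<open>S\<close> and \<open>T\<close>, and it is a multiple operator
  integral \<open>\<Sum>i\<^sub>1 \<dots> i\<^sub>l. g (\<lambda>\<^sub>1, \<dots>, \<lambda>\<^sub>l) M\<^sub>1 P\<^sub>i\<^sub>1 \<dots> M\<^sub>l P\<^sub>i\<^sub>l\<close>, in which \<open>\<lambda>\<^sub>j\<close> is the eigenvalue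
  number \<open>i\<^sub>j\<close> of \<open>S\<close> or of \<open>T\<close> and the \<open>M\<^sub>j\<close> are matrix curves.  For projections at two times
  \<open>s\<close> and \<open>t\<close>, with eigenvalues \<open>\<lambda>\<close> and \<open>\<mu>\<close> of a curve \<open>A\<close>, the identity
  \<open>(\<lambda> - \<mu>) P Q = P (A s - A t) Q\<close> shows that moving one factor from time \<open>t\<close> to time \<open>s\<close>
  replaces \<open>g\<close> by its divided difference in one variable and inserts the increment of \<open>A\<close> as a
  new letter.  Hence the derivative of such an integral is a finite sum of integrals of the same
  kind, with symbol \<open>g\<close> or a divided difference of \<open>g\<close>, and with letters that are derivatives of
  the given curves (\<open>curve_integral_has_derivative\<close>).

  Two analytic facts make this work.  A divided difference of a \<open>C\<^sup>m\<^sup>+\<^sup>1\<close> function is \<open>C\<^sup>m\<close>,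
  because it is an average of a partial derivative (\<open>smooth_divided_difference\<close>).  And an integral
  with a continuous symbol is continuous, which follows from the same identity: it makes the
  product \<open>P Q\<close> small unless the two eigenvalues are close (\<open>tendsto_spectral_sum\<close>).  Induction on
  \<open>m\<close> then gives the theorem.  That matrix functions make sense on \<open>CS2\<close> at all is the
  spectral theorem for commuting pairs (\<open>joint_diagonalization_exists\<close>).\<close>

section \<open>Simultaneous diagonalization\<close>

text \<open>The Rayleigh quotient of a symmetric operator attains its maximum on the compact unit
  sphere of an invariant subspace, and a maximizer is an eigenvector: otherwise moving it in the
  direction of its residual would increase the quotient.\<close>

lemma symmetric_on_subspace_has_eigenvector:
  fixes A :: "'a::euclidean_space \<Rightarrow> 'a"
  assumes lin: "linear A" and V: "subspace V" "V \<noteq> {0}"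
    and inv: "\<And>v. v \<in> V \<Longrightarrow> A v \<in> V"
    and sym: "\<And>u v. u \<in> V \<Longrightarrow> v \<in> V \<Longrightarrow> u \<bullet> A v = A u \<bullet> v"
  shows "\<exists>v\<in>V. \<exists>l. norm v = 1 \<and> A v = l *\<^sub>R v"
proof -
  interpret A: linear A by (fact lin)
  obtain u where u: "u \<in> V" "u \<noteq> 0"
    using V subspace_0 by blast
  have "u /\<^sub>R norm u \<in> V \<inter> sphere 0 1"
    using u V by (auto simp: subspace_scale)
  moreover have "compact (V \<inter> sphere 0 1)"
    using closed_subspace[OF V(1)] by (intro closed_Int_compact) auto
  moreover have "continuous_on (V \<inter> sphere 0 1) (\<lambda>v. v \<bullet> A v)"
    using lin by (intro continuous_on_inner continuous_on_id linear_continuous_on)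
      (simp add: linear_conv_bounded_linear)
  ultimately obtain v where "v \<in> V \<inter> sphere 0 1"
    and "\<forall>w\<in>V \<inter> sphere 0 1. w \<bullet> A w \<le> v \<bullet> A v"
    using continuous_attains_sup[of "V \<inter> sphere 0 1" "\<lambda>v. v \<bullet> A v"] by blast
  then have v: "v \<in> V" "norm v = 1"
    and max: "\<And>w. w \<in> V \<Longrightarrow> norm w = 1 \<Longrightarrow> w \<bullet> A w \<le> v \<bullet> A v"
    by auto
  define l where "l = v \<bullet> A v"
  have max': "w \<bullet> A w \<le> l * (w \<bullet> w)" if "w \<in> V" for w
  proof (cases "w = 0")
    case False
    have "(w /\<^sub>R norm w) \<bullet> A (w /\<^sub>R norm w) \<le> l"
      unfolding l_def using that V False by (intro max) (auto simp: subspace_scale)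
    then have "(w \<bullet> A w) / (norm w)\<^sup>2 \<le> l"
      by (simp add: A.scaleR power2_eq_square divide_simps)
    then show ?thesis
      using False by (simp add: divide_le_eq power2_norm_eq_inner)
  qed (simp add: A.zero)
  define w where "w = A v - l *\<^sub>R v"
  have w: "w \<in> V"
    unfolding w_def using V v inv by (simp add: subspace_diff subspace_scale)
  have vv: "v \<bullet> v = 1" using v by (simp add: dot_square_norm)
  have wv: "w \<bullet> v = 0" unfolding w_def l_def by (simp add: inner_diff_left inner_diff_right vv
        inner_commute[of "A v" v])
  have wAv: "w \<bullet> A v = w \<bullet> w"
    using wv by (simp add: w_def inner_diff_right inner_diff_left)
  have ineq: "2 * r * (w \<bullet> w) \<le> r\<^sup>2 * (l * (w \<bullet> w) - w \<bullet> A w)" for r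
  proof -
    have "(v + r *\<^sub>R w) \<bullet> A (v + r *\<^sub>R w) \<le> l * ((v + r *\<^sub>R w) \<bullet> (v + r *\<^sub>R w))"
      using V v w by (intro max') (simp add: subspace_add subspace_scale)
    moreover have "v \<bullet> A w = w \<bullet> w"
      using sym[OF v(1) w] wAv by (simp add: inner_commute)
    ultimately show ?thesis
      using wAv wv vv l_def
      by (simp add: A.add A.scaleR inner_add_left inner_add_right power2_eq_square algebra_simps
          inner_commute[of v w])
  qed
  have "w \<bullet> w = 0"
  proof (rule ccontr)
    assume "w \<bullet> w \<noteq> 0"
    then have c: "w \<bullet> w > 0" by simp
    \<comment> \<open>For this \<open>r\<close> the first-order gain exceeds the quadratic correction \<open>r\<^sup>2 d\<close>.\<close>
    define d where "d = l * (w \<bullet> w) - w \<bullet> A w"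
    define r where "r = (w \<bullet> w) / (\<bar>d\<bar> + 1)"
    have r: "r > 0" unfolding r_def using c by simp
    have "r * (2 * (w \<bullet> w)) \<le> r * (r * d)"
      using ineq[of r] by (simp add: d_def power2_eq_square mult_ac)
    then have "2 * (w \<bullet> w) \<le> r * d" using r by simp
    also have "\<dots> \<le> r * (\<bar>d\<bar> + 1)" using r by (intro mult_left_mono) auto
    also have "\<dots> = w \<bullet> w" unfolding r_def by simp
    finally show False using c by simp
  qed
  then have "A v = l *\<^sub>R v" by (simp add: w_def)
  with v show ?thesis by blast
qed

lemma commuting_symmetric_on_subspace_have_joint_eigenvector:
  fixes A B :: "'a::euclidean_space \<Rightarrow> 'a"
  assumes "linear A" "linear B" "subspace V" "V \<noteq> {0}"
    and "\<And>v. v \<in> V \<Longrightarrow> A v \<in> V" "\<And>v. v \<in> V \<Longrightarrow> B v \<in> V"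
    and "\<And>u v. u \<bullet> A v = A u \<bullet> v" "\<And>u v. u \<bullet> B v = B u \<bullet> v"
    and comm: "\<And>v. A (B v) = B (A v)"
  shows "\<exists>v\<in>V. norm v = 1 \<and> (\<exists>a. A v = a *\<^sub>R v) \<and> (\<exists>b. B v = b *\<^sub>R v)"
proof -
  interpret A: linear A by fact
  interpret B: linear B by fact
  obtain v a where v: "v \<in> V" "norm v = 1" "A v = a *\<^sub>R v"
    using symmetric_on_subspace_has_eigenvector[of A V] assms by blast
  define W where "W = {v \<in> V. A v = a *\<^sub>R v}"
  have W: "subspace W"
    using \<open>subspace V\<close>
    by (auto simp: W_def subspace_def A.zero A.add A.scaleR scaleR_add_right mult.commute)
  moreover have "v \<in> W" "v \<noteq> 0" using v by (simp_all add: W_def) auto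
  then have "W \<noteq> {0}" by blast
  moreover have "B u \<in> W" if "u \<in> W" for u
    using that assms(6) comm[of u] by (auto simp: W_def B.scaleR)
  ultimately obtain w b where "w \<in> W" "norm w = 1" "B w = b *\<^sub>R w"
    using symmetric_on_subspace_has_eigenvector[of B W, OF assms(2)] assms(8) by blast
  then show ?thesis unfolding W_def by blast
qed

lemma linear_complex_matrix_vector_mult: "linear (\<lambda>v. (A :: complex^'n^'m) *v v)"
  by (intro linearI)
    (simp_all add: vec_eq_iff matrix_vector_mult_def sum.distrib distrib_left scaleR_sum_right)

lemma self_adjoint_cnj: "self_adjoint A \<Longrightarrow> cnj (A $ i $ j) = A $ j $ i"
  unfolding self_adjoint_def conj_transpose_def vec_eq_iff by simp

lemma inner_self_adjoint:
  assumes "self_adjoint (A :: complex^'n^'n)"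
  shows "u \<bullet> (A *v v) = (A *v u) \<bullet> v"
proof -
  have cinner: "x \<bullet> y = Re (\<Sum>i\<in>UNIV. cnj (x $ i) * y $ i)" for x y :: "complex^'n"
    by (simp add: inner_vec_def inner_complex_def)
  have "(\<Sum>i\<in>UNIV. cnj (u $ i) * (A *v v) $ i)
      = (\<Sum>i\<in>UNIV. \<Sum>j\<in>UNIV. cnj (u $ i) * (A $ i $ j * v $ j))"
    by (simp add: matrix_vector_mult_def sum_distrib_left)
  also have "\<dots> = (\<Sum>j\<in>UNIV. \<Sum>i\<in>UNIV. cnj (u $ i) * (A $ i $ j * v $ j))"
    by (rule sum.swap)
  also have "\<dots> = (\<Sum>j\<in>UNIV. cnj ((A *v u) $ j) * v $ j)"
    by (simp add: matrix_vector_mult_def sum_distrib_left sum_distrib_right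
        self_adjoint_cnj[OF assms] mult_ac)
  finally show ?thesis by (simp add: cinner)
qed

definition cinner :: "complex^'n \<Rightarrow> complex^'n \<Rightarrow> complex" where
  "cinner u v = (\<Sum>i\<in>UNIV. cnj (u $ i) * v $ i)"

text \<open>Orthogonality in \<open>\<complex>\<^sup>n\<close> is orthogonality of \<open>v\<close> to both \<open>u\<close> and \<open>\<i>u\<close> for the real inner
  product, which makes the real theory of subspaces of a Euclidean space available.\<close>

lemma cinner_eq_0_iff: "cinner u v = 0 \<longleftrightarrow> u \<bullet> v = 0 \<and> (\<i> *s u) \<bullet> v = 0"
proof -
  have "u \<bullet> v = Re (cinner u v)" "(\<i> *s u) \<bullet> v = Im (cinner u v)"
    by (simp_all add: cinner_def inner_vec_def inner_complex_def sum_subtractf add.commute)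
  then show ?thesis by (simp add: complex_eq_iff)
qed

lemma cinner_commute: "cinner v u = cnj (cinner u v)"
  by (simp add: cinner_def mult.commute)

lemma cinner_self: "cinner v v = of_real ((norm v)\<^sup>2)"
proof -
  have "norm v ^ 2 = (\<Sum>i\<in>UNIV. (cmod (v $ i))\<^sup>2)"
    by (simp add: norm_vec_def L2_set_def sum_nonneg)
  then show ?thesis by (simp add: cinner_def mult.commute flip: complex_norm_square)
qed

text \<open>While fewer than \<open>n\<close> orthonormal joint eigenvectors have been found, a dimension count
  leaves a nonzero orthogonal complement; it is invariant, hence contains another one.\<close>

lemma joint_orthonormal_eigenvectors:
  fixes S T :: "complex^'n^'n"
  assumes S: "self_adjoint S" and T: "self_adjoint T" and comm: "S ** T = T ** S"
    and "k \<le> CARD('n)"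
  shows "\<exists>B. finite B \<and> card B = k \<and>
    (\<forall>b\<in>B. norm b = 1 \<and> (\<exists>s. S *v b = s *\<^sub>R b) \<and> (\<exists>t. T *v b = t *\<^sub>R b)) \<and>
    (\<forall>b\<in>B. \<forall>c\<in>B. b \<noteq> c \<longrightarrow> cinner b c = 0)"
  using \<open>k \<le> CARD('n)\<close>
proof (induction k)
  case 0
  show ?case by (intro exI[of _ "{}"]) auto
next
  case (Suc k)
  then obtain B where B: "finite B" "card B = k"
    "\<And>b. b \<in> B \<Longrightarrow> norm b = 1"
    "\<And>b. b \<in> B \<Longrightarrow> \<exists>s. S *v b = s *\<^sub>R b" "\<And>b. b \<in> B \<Longrightarrow> \<exists>t. T *v b = t *\<^sub>R b"
    "\<And>b c. b \<in> B \<Longrightarrow> c \<in> B \<Longrightarrow> b \<noteq> c \<Longrightarrow> cinner b c = 0"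
    by auto
  define V where "V = {v. \<forall>b\<in>B. b \<bullet> v = 0 \<and> (\<i> *s b) \<bullet> v = 0}"
  have sub: "subspace V"
    by (auto simp: V_def subspace_def inner_add_right)
  have "dim (B \<union> (*s) \<i> ` B) \<le> card (B \<union> (*s) \<i> ` B)"
    using B by (intro dim_le_card') auto
  also have "\<dots> \<le> 2 * k"
    using card_Un_le[of B "(*s) \<i> ` B"] card_image_le[of B "(*s) \<i>"] B by simp
  also have "\<dots> < DIM(complex^'n)" using Suc.prems by simp
  finally obtain v where v: "v \<noteq> 0" "\<And>y. y \<in> span (B \<union> (*s) \<i> ` B) \<Longrightarrow> orthogonal v y"
    using orthogonal_to_subspace_exists by blast
  have "v \<in> V"
    unfolding V_def using v(2)
    by (auto simp: orthogonal_def inner_commute[of _ v] intro: span_base)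
  then have ne: "V \<noteq> {0}" using v by auto
  have inv: "A *v v \<in> V" if v: "v \<in> V" and A: "self_adjoint A"
    and eig: "\<And>b. b \<in> B \<Longrightarrow> \<exists>a. A *v b = a *\<^sub>R b" for A v
  proof -
    have "b \<bullet> (A *v v) = 0 \<and> (\<i> *s b) \<bullet> (A *v v) = 0" if b: "b \<in> B" for b
    proof -
      obtain a where a: "A *v b = a *\<^sub>R b" using eig b by blast
      have "A *v (\<i> *s b) = \<i> *s (A *v b)" by (simp add: vector_scalar_commute)
      also have "\<dots> = a *\<^sub>R (\<i> *s b)" by (simp add: a vec_eq_iff)
      finally show ?thesis
        using v b a by (auto simp: inner_self_adjoint[OF A] V_def)
    qed
    then show ?thesis by (simp add: V_def)
  qed
  obtain v where v: "v \<in> V" "norm v = 1" "\<exists>s. S *v v = s *\<^sub>R v" "\<exists>t. T *v v = t *\<^sub>R v"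
    using commuting_symmetric_on_subspace_have_joint_eigenvector[of "(*v) S" "(*v) T" V]
      linear_complex_matrix_vector_mult sub ne inv S T B(4,5) inner_self_adjoint comm
    by (metis (no_types, lifting) matrix_vector_mul_assoc)
  have orth: "cinner b v = 0" if "b \<in> B" for b
    using v(1) that by (auto simp: V_def cinner_eq_0_iff)
  have "v \<notin> B" using orth[of v] v(2) by (auto simp: cinner_self)
  have orth': "cinner v b = 0" if "b \<in> B" for b
    using orth[OF that] cinner_commute[of v b] by simp
  show ?case
  proof (intro exI[of _ "insert v B"] conjI ballI impI)
    show "finite (insert v B)" "card (insert v B) = Suc k"
      using B(1,2) \<open>v \<notin> B\<close> by simp_all
  next
    fix b assume b: "b \<in> insert v B"
    show "norm b = 1" using b v(2) B(3) by blast
    show "\<exists>s. S *v b = s *\<^sub>R b" using b v(3) B(4) by blast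
    show "\<exists>t. T *v b = t *\<^sub>R b" using b v(4) B(5) by blast
    fix c assume "c \<in> insert v B" "b \<noteq> c"
    then show "cinner b c = 0" using b orth orth' B(6) by blast
  qed
qed

lemma joint_diagonalization_exists:
  fixes S T :: "complex^'n^'n"
  assumes "(S, T) \<in> CS2"
  shows "\<exists>U x y. joint_diagonalization U x y S T"
proof -
  from assms have S: "self_adjoint S" and T: "self_adjoint T" and comm: "S ** T = T ** S"
    by (auto simp: CS2_def)
  obtain B where B: "finite B" "card B = CARD('n)"
    "\<And>b. b \<in> B \<Longrightarrow> norm b = 1"
    "\<And>b. b \<in> B \<Longrightarrow> \<exists>s. S *v b = s *\<^sub>R b" "\<And>b. b \<in> B \<Longrightarrow> \<exists>t. T *v b = t *\<^sub>R b"
    "\<And>b c. b \<in> B \<Longrightarrow> c \<in> B \<Longrightarrow> b \<noteq> c \<Longrightarrow> cinner b c = 0"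
    using joint_orthonormal_eigenvectors[OF S T comm order_refl] by auto
  obtain h where h: "bij_betw h (UNIV :: 'n set) B"
    using finite_same_card_bij[of "UNIV :: 'n set" B] B by auto
  have hB: "h i \<in> B" for i using h by (auto simp: bij_betw_def)
  obtain x y where x: "\<And>i. S *v h i = x i *\<^sub>R h i" and y: "\<And>i. T *v h i = y i *\<^sub>R h i"
    using B(4,5)[OF hB] by metis
  define U :: "complex^'n^'n" where "U = (\<chi> a i. h i $ a)"
  have "cinner (h i) (h j) = (if i = j then 1 else 0)" for i j
  proof (cases "i = j")
    case False
    then have "h i \<noteq> h j" using h by (auto simp: bij_betw_def dest: injD)
    then show ?thesis using B(6)[OF hB hB] False by simp
  qed (simp add: B(3)[OF hB] cinner_self)
  then have U1: "conj_transpose U ** U = mat 1"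
    by (simp add: vec_eq_iff U_def conj_transpose_def matrix_matrix_mult_def mat_def cinner_def)
  then have U2: "U ** conj_transpose U = mat 1"
    by (simp add: matrix_left_right_inverse)
  have diag: "A = U ** diag_matrix a ** conj_transpose U" if a: "\<And>i. A *v h i = a i *\<^sub>R h i" for A a
  proof -
    have "(A ** U) $ r $ i = (A *v h i) $ r" for r i
      by (simp add: U_def matrix_matrix_mult_def matrix_vector_mult_def)
    also have "(A *v h i) $ r = h i $ r * of_real (a i)" for r i
      by (simp add: a scaleR_conv_of_real[where 'a = complex])
    finally have "A ** U = U ** diag_matrix a"
      by (simp add: vec_eq_iff matrix_mult_diag_right U_def)
    then have "U ** diag_matrix a ** conj_transpose U = A ** (U ** conj_transpose U)"
      by (simp add: matrix_mul_assoc)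
    then show ?thesis using U2 by simp
  qed
  show ?thesis
    unfolding joint_diagonalization_def unitary_def
    using U1 U2 diag[OF x] diag[OF y] by blast
qed

section \<open>Functions of class \<open>C\<^sup>m\<close> in countably many variables\<close>

text \<open>Keeping infinitely many variables avoids a change of type whenever a divided difference
  introduces a new one.\<close>

primrec smooth_on_box :: "nat \<Rightarrow> (nat \<Rightarrow> real set) \<Rightarrow> ((nat \<Rightarrow> real) \<Rightarrow> real) \<Rightarrow> bool" where
  "smooth_on_box 0 J g \<longleftrightarrow> continuous_on (Pi UNIV J) g"
| "smooth_on_box (Suc m) J g \<longleftrightarrow> continuous_on (Pi UNIV J) g \<and>
    (\<forall>q. \<exists>g'. (\<forall>z\<in>Pi UNIV J. ((\<lambda>s. g (z(q := s))) has_real_derivative g' z) (at (z q))) \<and>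
      smooth_on_box m J g')"

definition independent_of :: "(nat \<Rightarrow> real set) \<Rightarrow> nat \<Rightarrow> ((nat \<Rightarrow> real) \<Rightarrow> real) \<Rightarrow> bool" where
  "independent_of J d g \<longleftrightarrow> (\<forall>z\<in>Pi UNIV J. \<forall>r\<in>J d. g (z(d := r)) = g z)"

lemma smooth_on_box_continuous: "smooth_on_box m J g \<Longrightarrow> continuous_on (Pi UNIV J) g"
  by (cases m) auto

lemma smooth_on_box_Suc_imp: "smooth_on_box (Suc m) J g \<Longrightarrow> smooth_on_box m J g"
proof (induction m arbitrary: g)
  case (Suc m)
  from Suc.prems have c: "continuous_on (Pi UNIV J) g" by simp
  have "\<exists>g'. (\<forall>z\<in>Pi UNIV J. ((\<lambda>s. g (z(q := s))) has_real_derivative g' z) (at (z q))) \<and>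
      smooth_on_box m J g'" for q
    using Suc.prems Suc.IH unfolding smooth_on_box.simps(2)[of "Suc m"] by blast
  then show ?case using c unfolding smooth_on_box.simps(2) by blast
qed simp

lemma smooth_on_box_zero: "smooth_on_box m J (\<lambda>z. 0)"
  by (induction m) (auto intro!: exI[of _ "\<lambda>z. 0"])

lemma upd_in_box: "z \<in> Pi UNIV J \<Longrightarrow> s \<in> J q \<Longrightarrow> z(q := s) \<in> Pi UNIV J"
  by auto

lemma partial_deriv_independent:
  assumes g: "\<And>z. z \<in> Pi UNIV J \<Longrightarrow> ((\<lambda>s. g (z(q := s))) has_real_derivative g' z) (at (z q))"
    and ind: "independent_of J d g" and "q \<noteq> d" "open (J q)"
  shows "independent_of J d g'"
  unfolding independent_of_def
proof (intro ballI)
  fix z r assume z: "z \<in> Pi UNIV J" and r: "r \<in> J d"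
  have zr: "z(d := r) \<in> Pi UNIV J" using z r by auto
  have "((\<lambda>s. g ((z(d := r))(q := s))) has_real_derivative g' (z(d := r))) (at (z q))"
    using g[OF zr] \<open>q \<noteq> d\<close> by simp
  then have "((\<lambda>s. g (z(q := s))) has_real_derivative g' (z(d := r))) (at (z q))"
  proof (rule has_field_derivative_transform_within_open)
    show "g ((z(d := r))(q := s)) = g (z(q := s))" if "s \<in> J q" for s
      using ind upd_in_box[OF z that] r \<open>q \<noteq> d\<close>
      unfolding independent_of_def by (metis fun_upd_twist)
  qed (use z assms(4) in auto)
  then show "g' (z(d := r)) = g' z"
    using g[OF z] DERIV_unique by blast
qed

text \<open>A path, in the variable \<open>q\<close>, from the first node of a divided difference to the second.\<close>

definition slide :: "nat \<Rightarrow> nat \<Rightarrow> (nat \<Rightarrow> real) \<Rightarrow> real \<Rightarrow> nat \<Rightarrow> real" where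
  "slide q d z u = z(q := (1 - u) * z q + u * z d)"

lemma slide_in_box:
  assumes "z \<in> Pi UNIV J" "J d = J q" "convex (J q)" "u \<in> {0..1}"
  shows "slide q d z u \<in> Pi UNIV J"
proof -
  have "(1 - u) * z q + u * z d \<in> J q"
    using assms convexD[of "J q" "z q" "z d" "1 - u" u] by (auto simp: Pi_iff)
  then show ?thesis using assms by (auto simp: slide_def)
qed

lemma continuous_on_slide:
  "continuous_on S (\<lambda>p. slide q d (fst p) (snd p))"
proof (rule continuous_on_coordinatewise_then_product)
  fix i
  have "continuous_on S (\<lambda>p :: (nat \<Rightarrow> real) \<times> real. fst p k)" for k
    by (rule continuous_on_product_then_coordinatewise[OF continuous_on_fst[OF continuous_on_id]])
  then show "continuous_on S (\<lambda>p. slide q d (fst p) (snd p) i)"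
    by (cases "i = q") (auto simp: slide_def intro!: continuous_intros)
qed

lemma continuous_on_upd: "continuous_on S (\<lambda>s. z(j := s :: real))"
proof (rule continuous_on_coordinatewise_then_product)
  fix i show "continuous_on S (\<lambda>s. (z(j := s)) i)"
    by (cases "i = j") (auto intro!: continuous_intros)
qed

definition segment_average ::
  "nat \<Rightarrow> nat \<Rightarrow> (real \<Rightarrow> real) \<Rightarrow> ((nat \<Rightarrow> real) \<Rightarrow> real) \<Rightarrow> (nat \<Rightarrow> real) \<Rightarrow> real" where
  "segment_average q d w h z = integral (cbox 0 1) (\<lambda>u. w u * h (slide q d z u))"

context
  fixes J :: "nat \<Rightarrow> real set" and q d :: nat
  assumes J: "\<And>k. open (J k)" "\<And>k. convex (J k)" "J d = J q" and qd: "q \<noteq> d"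
begin

lemma continuous_on_weighted_slide:
  fixes h :: "(nat \<Rightarrow> real) \<Rightarrow> real" and w :: "real \<Rightarrow> real"
  assumes "continuous_on (Pi UNIV J) h" "continuous_on UNIV w"
  shows "continuous_on (Pi UNIV J \<times> cbox 0 1) (\<lambda>p. w (snd p) * h (slide q d (fst p) (snd p)))"
proof (intro continuous_on_mult)
  show "continuous_on (Pi UNIV J \<times> cbox 0 1) (\<lambda>p. w (snd p))"
    by (rule continuous_on_compose2[OF assms(2)]) (auto intro!: continuous_intros)
  show "continuous_on (Pi UNIV J \<times> cbox 0 1) (\<lambda>p. h (slide q d (fst p) (snd p)))"
    by (rule continuous_on_compose2[OF assms(1) continuous_on_slide])
      (rule image_subsetI, rule slide_in_box[OF _ J(3,2)], auto)
qed

lemma continuous_on_segment_average: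
  assumes "continuous_on (Pi UNIV J) h" "continuous_on UNIV w"
  shows "continuous_on (Pi UNIV J) (segment_average q d w h)"
  using integral_continuous_on_param[of "Pi UNIV J" 0 1 "\<lambda>z u. w u * h (slide q d z u)"]
    continuous_on_weighted_slide[OF assms]
  by (simp add: segment_average_def[abs_def] case_prod_unfold)

text \<open>Differentiation under the integral sign; the weight \<open>v\<close> comes from the chain rule.\<close>

lemma segment_average_partial:
  assumes h: "continuous_on (Pi UNIV J) h" and h': "continuous_on (Pi UNIV J) h'"
    and w: "continuous_on UNIV w" and v: "continuous_on UNIV v"
    and der: "\<And>z u. z \<in> Pi UNIV J \<Longrightarrow> u \<in> {0..1} \<Longrightarrow>
      ((\<lambda>s. h (slide q d (z(j := s)) u)) has_real_derivative v u * h' (slide q d z u)) (at (z j))"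
    and z: "z \<in> Pi UNIV J"
  shows "((\<lambda>s. segment_average q d w h (z(j := s))) has_real_derivative
    segment_average q d (\<lambda>u. w u * v u) h' z) (at (z j))"
proof -
  have box: "z(j := s) \<in> Pi UNIV J" if "s \<in> J j" for s using z that by auto
  have "((\<lambda>s. integral (cbox 0 1) (\<lambda>u. w u * h (slide q d (z(j := s)) u))) has_real_derivative
    integral (cbox 0 1) (\<lambda>u. w u * (v u * h' (slide q d (z(j := z j)) u)))) (at (z j) within J j)"
  proof (rule leibniz_rule_field_derivative)
    fix s u :: real assume s: "s \<in> J j" and u: "u \<in> cbox 0 1"
    have "((\<lambda>r. h (slide q d ((z(j := s))(j := r)) u)) has_real_derivative
        v u * h' (slide q d (z(j := s)) u)) (at ((z(j := s)) j))"
      using u by (intro der[OF box[OF s]]) auto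
    then show "((\<lambda>s. w u * h (slide q d (z(j := s)) u)) has_real_derivative
        w u * (v u * h' (slide q d (z(j := s)) u))) (at s within J j)"
      by (auto intro: DERIV_cmult has_field_derivative_at_within)
  next
    fix s assume s: "s \<in> J j"
    have "continuous_on (cbox 0 1) (\<lambda>u :: real. (z(j := s), u))"
      by (intro continuous_intros)
    from continuous_on_compose2[OF continuous_on_weighted_slide[OF h w] this] box[OF s]
    have "continuous_on (cbox 0 1) (\<lambda>u. w u * h (slide q d (z(j := s)) u))"
      by auto
    then show "(\<lambda>u. w u * h (slide q d (z(j := s)) u)) integrable_on cbox 0 1"
      by (rule integrable_continuous)
  next
    have "continuous_on UNIV (\<lambda>u. w u * v u)" using w v by (intro continuous_intros)
    note cont = continuous_on_weighted_slide[OF h' this]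
    have "continuous_on (J j \<times> cbox (0::real) 1) (\<lambda>p. (z(j := fst p), snd p))"
      by (intro continuous_on_Pair continuous_on_compose2[OF continuous_on_upd[of UNIV]]
          continuous_intros) auto
    from continuous_on_compose2[OF cont this]
    have "continuous_on (J j \<times> cbox 0 1)
        (\<lambda>p. w (snd p) * v (snd p) * h' (slide q d (z(j := fst p)) (snd p)))"
      using box by fastforce
    then show "continuous_on (J j \<times> cbox 0 1) (\<lambda>(s, u). w u * (v u * h' (slide q d (z(j := s)) u)))"
      by (simp add: case_prod_unfold mult.assoc)
  qed (use z J in auto)
  then show ?thesis
    using z J(1) at_within_open[of "z j" "J j"]
    by (simp add: segment_average_def mult.assoc Pi_iff)
qed

text \<open>All partial derivatives of an average are again averages, of partial derivatives of the
  averaged function.  Independence of the variable \<open>d\<close>, which the average uses for the second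
  endpoint, keeps the chain rule to a single term.\<close>

lemma smooth_on_box_segment_average:
  assumes "smooth_on_box m J h" "independent_of J d h" "continuous_on UNIV w"
  shows "smooth_on_box m J (segment_average q d w h)"
  using assms
proof (induction m arbitrary: h w)
  case 0
  then show ?case using continuous_on_segment_average by simp
next
  case (Suc m)
  have h: "continuous_on (Pi UNIV J) h" using Suc.prems by simp
  have "\<exists>g'. (\<forall>z\<in>Pi UNIV J. ((\<lambda>s. segment_average q d w h (z(j := s))) has_real_derivative g' z)
      (at (z j))) \<and> smooth_on_box m J g'" for j
  proof -
    define j' where "j' = (if j = d then q else j)"
    \<comment> \<open>The factor from the chain rule: moving coordinate \<open>j\<close> moves coordinate \<open>j'\<close> of
      \<open>slide q d z u\<close> with this speed.\<close>
    define v :: "real \<Rightarrow> real" where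
      "v = (if j = q then (\<lambda>u. 1 - u) else if j = d then (\<lambda>u. u) else (\<lambda>u. 1))"
    obtain h' where h': "\<And>z. z \<in> Pi UNIV J \<Longrightarrow>
        ((\<lambda>s. h (z(j' := s))) has_real_derivative h' z) (at (z j'))" "smooth_on_box m J h'"
      using Suc.prems(1) by fastforce
    have "j' \<noteq> d" using qd by (simp add: j'_def)
    then have ind': "independent_of J d h'"
      using partial_deriv_independent[OF h'(1) Suc.prems(2)] J(1) by blast
    have v: "continuous_on UNIV v" by (auto simp: v_def intro!: continuous_intros)
    have der: "((\<lambda>s. h (slide q d (z(j := s)) u)) has_real_derivative v u * h' (slide q d z u))
        (at (z j))" if z: "z \<in> Pi UNIV J" and u: "u \<in> {0..1}" for z u
    proof -
      have sl: "slide q d z u \<in> Pi UNIV J" using slide_in_box[OF z J(3,2) u] .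
      consider "j = q" | "j = d" | "j \<noteq> q" "j \<noteq> d" by blast
      then show ?thesis
      proof cases
        case 1
        have "((\<lambda>s. (1 - u) * s + u * z d) has_real_derivative (1 - u)) (at (z q))"
          by (auto intro!: derivative_eq_intros)
        from DERIV_chain2[OF _ this, of "\<lambda>s. h (z(q := s))" "h' (slide q d z u)"] h'(1)[OF sl] 1 qd
        show ?thesis by (simp add: j'_def v_def slide_def mult.commute)
      next
        case 2
        have "((\<lambda>s. (1 - u) * z q + u * s) has_real_derivative u) (at (z d))"
          by (auto intro!: derivative_eq_intros)
        from DERIV_chain2[OF _ this, of "\<lambda>s. h (z(q := s))" "h' (slide q d z u)"] h'(1)[OF sl] 2 qd
        have "((\<lambda>s. h (z(q := (1 - u) * z q + u * s))) has_real_derivative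
            v u * h' (slide q d z u)) (at (z d))"
          by (simp add: j'_def v_def slide_def mult.commute)
        then have "((\<lambda>s. h (slide q d (z(d := s)) u)) has_real_derivative
            v u * h' (slide q d z u)) (at (z d))"
        proof (rule has_field_derivative_transform_within_open)
          fix s assume s: "s \<in> J d"
          have "slide q d (z(d := s)) u \<in> Pi UNIV J"
            using s z by (intro slide_in_box J u) auto
          then have "h ((slide q d (z(d := s)) u)(d := z d)) = h (slide q d (z(d := s)) u)"
            using Suc.prems(2) z unfolding independent_of_def by blast
          moreover have "(slide q d (z(d := s)) u)(d := z d) = z(q := (1 - u) * z q + u * s)"
            using qd by (auto simp: slide_def fun_eq_iff)
          ultimately show "h (z(q := (1 - u) * z q + u * s)) = h (slide q d (z(d := s)) u)"
            by simp
        qed (use z J in auto)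
        then show ?thesis using 2 by simp
      next
        case 3
        then have "slide q d (z(j := s)) u = (slide q d z u)(j := s)" for s
          by (auto simp: slide_def)
        then show ?thesis using h'(1)[OF sl] 3 by (simp add: j'_def v_def slide_def)
      qed
    qed
    have "continuous_on UNIV (\<lambda>u. w u * v u)" using Suc.prems(3) v by (intro continuous_intros)
    then show ?thesis
      using segment_average_partial[OF h smooth_on_box_continuous[OF h'(2)] Suc.prems(3) v der]
        Suc.IH[OF h'(2) ind'] by blast
  qed
  then show ?case
    using continuous_on_segment_average[OF h Suc.prems(3)] by simp
qed

text \<open>Hadamard's lemma: the divided difference in one variable loses one derivative.  As a
  function of the two nodes it is the average of the partial derivative between them.\<close>

lemma smooth_divided_difference:
  assumes g: "smooth_on_box (Suc m) J g" and ind: "\<And>k. N \<le> k \<Longrightarrow> independent_of J k g"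
    and N: "q < N" "N \<le> d"
  obtains g1 where "smooth_on_box m J g1" "\<And>k. d < k \<Longrightarrow> independent_of J k g1"
    "\<And>z a b. z \<in> Pi UNIV J \<Longrightarrow> a \<in> J q \<Longrightarrow> b \<in> J q \<Longrightarrow>
      g (z(q := a)) - g (z(q := b)) = (a - b) * g1 (z(q := a, d := b))"
proof -
  obtain h where h: "\<And>z. z \<in> Pi UNIV J \<Longrightarrow>
      ((\<lambda>s. g (z(q := s))) has_real_derivative h z) (at (z q))" "smooth_on_box m J h"
    using g by fastforce
  have indh: "independent_of J k h" if "N \<le> k" for k
    using partial_deriv_independent[OF h(1) ind[OF that]] J(1) N that by auto
  have "independent_of J k (segment_average q d (\<lambda>u. 1) h)" if k: "d < k" for k
    unfolding independent_of_def
  proof (intro ballI)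
    fix z r assume z: "z \<in> Pi UNIV J" and r: "r \<in> J k"
    have "h (slide q d (z(k := r)) u) = h (slide q d z u)" if u: "u \<in> cbox 0 1" for u
    proof -
      have "slide q d (z(k := r)) u = (slide q d z u)(k := r)"
        using k N by (auto simp: slide_def)
      then show ?thesis
        using indh[of k] k N slide_in_box[OF z J(3,2)] u r by (auto simp: independent_of_def)
    qed
    then show "segment_average q d (\<lambda>u. 1) h (z(k := r)) = segment_average q d (\<lambda>u. 1) h z"
      unfolding segment_average_def by (intro integral_cong) simp
  qed
  then have ind1: "\<And>k. d < k \<Longrightarrow> independent_of J k (segment_average q d (\<lambda>u. 1) h)"
    by blast
  have diff: "g (z(q := a)) - g (z(q := b)) =
      (a - b) * segment_average q d (\<lambda>u. 1) h (z(q := a, d := b))"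
    if z: "z \<in> Pi UNIV J" and a: "a \<in> J q" and b: "b \<in> J q" for z a b
  proof -
    define y where "y = z(q := a, d := b)"
    have y: "y \<in> Pi UNIV J" using z a b J(3) by (auto simp: y_def)
    have "((\<lambda>u. (b - a) * h (slide q d y u)) has_integral
        g (slide q d y 1) - g (slide q d y 0)) {0..1}"
    proof (rule fundamental_theorem_of_calculus)
      fix u :: real assume u: "u \<in> {0..1}"
      have "((\<lambda>u. (1 - u) * a + u * b) has_real_derivative (b - a)) (at u)"
        by (auto intro!: derivative_eq_intros)
      from DERIV_chain2[OF _ this, of "\<lambda>s. g (y(q := s))" "h (slide q d y u)"]
        h(1)[OF slide_in_box[OF y J(3,2) u]] qd
      have "((\<lambda>u. g (slide q d y u)) has_real_derivative h (slide q d y u) * (b - a)) (at u)"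
        by (simp add: slide_def y_def)
      then show "((\<lambda>u. g (slide q d y u)) has_vector_derivative (b - a) * h (slide q d y u))
          (at u within {0..1})"
        by (simp add: mult.commute has_field_derivative_at_within
            flip: has_real_derivative_iff_has_vector_derivative)
    qed simp
    then have "(b - a) * segment_average q d (\<lambda>u. 1) h y = g (slide q d y 1) - g (slide q d y 0)"
      by (simp add: segment_average_def integral_unique flip: integral_mult_right)
    also have "slide q d y 1 = (z(q := b))(d := b)"
      using qd by (auto simp: slide_def y_def)
    also have "slide q d y 0 = (z(q := a))(d := b)"
      using qd by (auto simp: slide_def y_def)
    also have "g ((z(q := b))(d := b)) = g (z(q := b))"
      using ind[OF N(2)] upd_in_box[OF z b] b J(3) unfolding independent_of_def by blast
    also have "g ((z(q := a))(d := b)) = g (z(q := a))"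
      using ind[OF N(2)] upd_in_box[OF z a] b J(3) unfolding independent_of_def by blast
    finally show ?thesis by (simp add: y_def fun_upd_def left_diff_distrib)
  qed
  show thesis
    by (rule that[OF smooth_on_box_segment_average[OF h(2) indh[OF N(2)] continuous_on_const]
          ind1 diff])
qed

end

section \<open>Curves of class \<open>C\<^sup>m\<close>\<close>

text \<open>Unlike the iterated \<open>vector_derivative\<close>, this recursion peels off the first derivative,
  and it does not fix a choice of derivative where it is not unique.\<close>

primrec smooth_curve :: "nat \<Rightarrow> real set \<Rightarrow> (real \<Rightarrow> 'a::real_normed_vector) \<Rightarrow> bool" where
  "smooth_curve 0 I c \<longleftrightarrow> continuous_on I c"
| "smooth_curve (Suc m) I c \<longleftrightarrow>
    (\<exists>c'. (\<forall>t\<in>I. (c has_vector_derivative c' t) (at t within I)) \<and> smooth_curve m I c')"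

lemma smooth_curve_continuous: "smooth_curve m I c \<Longrightarrow> continuous_on I c"
  by (cases m) (auto simp: continuous_on_eq_continuous_within
      intro: has_vector_derivative_continuous)

lemma smooth_curve_Suc_imp: "smooth_curve (Suc m) I c \<Longrightarrow> smooth_curve m I c"
proof (induction m arbitrary: c)
  case 0
  then show ?case using smooth_curve_continuous[of "Suc 0"] by simp
next
  case (Suc m)
  then show ?case unfolding smooth_curve.simps(2)[of "Suc m"] smooth_curve.simps(2)[of m] by blast
qed

lemma smooth_curve_const: "smooth_curve m I (\<lambda>t. a)"
proof (induction m arbitrary: a)
  case (Suc m)
  then show ?case by (auto intro!: exI[of _ "\<lambda>t. 0"])
qed simp

lemma smooth_curve_add:
  "smooth_curve m I b \<Longrightarrow> smooth_curve m I c \<Longrightarrow> smooth_curve m I (\<lambda>t. b t + c t)"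
proof (induction m arbitrary: b c)
  case 0
  then show ?case by (auto intro: continuous_on_add)
next
  case (Suc m)
  obtain b' where "\<forall>t\<in>I. (b has_vector_derivative b' t) (at t within I)" "smooth_curve m I b'"
    using Suc.prems(1) by auto
  moreover obtain c' where "\<forall>t\<in>I. (c has_vector_derivative c' t) (at t within I)"
    "smooth_curve m I c'"
    using Suc.prems(2) by auto
  ultimately show ?case
    using Suc.IH by (auto intro!: exI[of _ "\<lambda>t. b' t + c' t"] has_vector_derivative_add)
qed

lemma smooth_curve_sum_list:
  "(\<And>x. x \<in> set L \<Longrightarrow> smooth_curve m I (c x)) \<Longrightarrow> smooth_curve m I (\<lambda>t. \<Sum>x\<leftarrow>L. c x t)"
  by (induction L) (auto intro: smooth_curve_const smooth_curve_add)

lemma has_vector_derivative_within_quotient: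
  "(c has_vector_derivative D) (at t within I) \<longleftrightarrow>
    ((\<lambda>s. (1 / (s - t)) *\<^sub>R (c s - c t)) \<longlongrightarrow> D) (at t within I)"
proof -
  have "norm ((c s - c t) - (s - t) *\<^sub>R D) / norm (s - t)
      = norm ((1 / (s - t)) *\<^sub>R (c s - c t) - D)" if "s \<noteq> t" for s
  proof -
    have "(1 / (s - t)) *\<^sub>R (c s - c t) - D = (1 / (s - t)) *\<^sub>R ((c s - c t) - (s - t) *\<^sub>R D)"
      using that by (simp add: scaleR_diff_right)
    then show ?thesis by simp
  qed
  then have "((\<lambda>s. norm ((c s - c t) - (s - t) *\<^sub>R D) / norm (s - t)) \<longlongrightarrow> 0) (at t within I)
      \<longleftrightarrow> ((\<lambda>s. norm ((1 / (s - t)) *\<^sub>R (c s - c t) - D)) \<longlongrightarrow> 0) (at t within I)"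
    by (intro filterlim_cong refl) (auto simp: eventually_at_filter)
  then show ?thesis
    by (simp add: has_vector_derivative_def has_derivative_iff_norm bounded_linear_scaleR_left
        tendsto_norm_zero_iff Lim_null[of _ D])
qed

section \<open>Multiple operator integrals\<close>

lemma bounded_bilinear_matrix_mult:
  "bounded_bilinear ((**) :: complex^'n^'n \<Rightarrow> complex^'n^'n \<Rightarrow> complex^'n^'n)"
proof -
  have "linear (\<lambda>Y :: complex^'n^'n. X ** Y)" "linear (\<lambda>Y :: complex^'n^'n. Y ** X)" for X :: "complex^'n^'n"
    by (auto intro!: linearI
        simp: vec_eq_iff matrix_matrix_mult_def distrib_left distrib_right sum.distrib scaleR_sum_right)
  then show ?thesis
    by (simp add: bilinear_def flip: bilinear_conv_bounded_bilinear)
qed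

interpretation matmul: bounded_bilinear "(**) :: complex^'n^'n \<Rightarrow> complex^'n^'n \<Rightarrow> complex^'n^'n"
  by (rule bounded_bilinear_matrix_mult)

lemma tendsto_fun_coordinatewise:
  fixes z :: "'b \<Rightarrow> 'c \<Rightarrow> 'd::topological_space"
  assumes "\<And>k. ((\<lambda>\<theta>. z \<theta> k) \<longlongrightarrow> l k) F"
  shows "(z \<longlongrightarrow> l) F"
  using assms limitin_componentwise[of "\<lambda>_. euclidean" UNIV z l F]
  by (simp add: euclidean_product_topology)

text \<open>A family of matrix curves \<open>A k\<close> that at each time share the rank-one spectral projections
  \<open>P t i\<close>, with eigenvalues \<open>e k t i\<close>.  No regularity of \<open>P\<close> and \<open>e\<close> in \<open>t\<close> is assumed: they are
  arbitrary choices at each time and in general cannot be made continuous.  The index \<open>k\<close> also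
  names the variable of a symbol into which the eigenvalues of \<open>A k\<close> are substituted, so every
  curve is listed infinitely often to provide fresh variables.\<close>

locale spectral_curves =
  fixes I :: "real set" and A :: "nat \<Rightarrow> real \<Rightarrow> complex^'n^'n"
    and P :: "real \<Rightarrow> 'n \<Rightarrow> complex^'n^'n" and e :: "nat \<Rightarrow> real \<Rightarrow> 'n \<Rightarrow> real"
    and J :: "nat \<Rightarrow> real set"
  assumes sum_P: "t \<in> I \<Longrightarrow> (\<Sum>i\<in>UNIV. P t i) = mat 1"
    and P_A: "t \<in> I \<Longrightarrow> P t i ** A k t = e k t i *\<^sub>R P t i"
    and A_P: "t \<in> I \<Longrightarrow> A k t ** P t i = e k t i *\<^sub>R P t i"
    and norm_P: "t \<in> I \<Longrightarrow> norm (P t i) = 1"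
    and e_in_J: "t \<in> I \<Longrightarrow> e k t i \<in> J k"
    and open_J: "open (J k)" and convex_J: "convex (J k)"
    and fresh: "\<exists>d\<ge>N. A d = A k \<and> e d = e k \<and> J d = J k"
    and cont_A: "continuous_on I (A k)"
begin

text \<open>For a word \<open>(M\<^sub>1, \<tau>\<^sub>1, k\<^sub>1) \<dots> (M\<^sub>l, \<tau>\<^sub>l, k\<^sub>l)\<close> with distinct variables \<open>k\<^sub>j\<close> this is
  \<open>\<Sum>i\<^sub>1 \<dots> i\<^sub>l. g (\<dots>, e k\<^sub>1 \<tau>\<^sub>1 i\<^sub>1, \<dots>, e k\<^sub>l \<tau>\<^sub>l i\<^sub>l) M\<^sub>1 P\<^sub>i\<^sub>1 M\<^sub>2 P\<^sub>i\<^sub>2 \<dots> M\<^sub>l P\<^sub>i\<^sub>l\<close>; the argument \<open>z\<close> supplies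
  the variables of the symbol \<open>g\<close> that do not occur in the word.\<close>

fun operator_integral ::
  "((nat \<Rightarrow> real) \<Rightarrow> real) \<Rightarrow> (nat \<Rightarrow> real) \<Rightarrow> ((complex^'n^'n) \<times> real \<times> nat) list \<Rightarrow> complex^'n^'n"
where
  "operator_integral g z [] = g z *\<^sub>R mat 1"
| "operator_integral g z ((M, \<tau>, k) # w) =
    M ** (\<Sum>i\<in>UNIV. P \<tau> i ** operator_integral g (z(k := e k \<tau> i)) w)"

lemma e_upd_in_box: "z \<in> Pi UNIV J \<Longrightarrow> t \<in> I \<Longrightarrow> z(k := e k t i) \<in> Pi UNIV J"
  by (rule upd_in_box) (auto intro: e_in_J)

text \<open>Each projection absorbs the matrix of its own time and leaves the eigenvalue.\<close>

lemma P_diff_P: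
  assumes "s \<in> I" "t \<in> I"
  shows "P s i ** (A k s - A k t) ** P t j = (e k s i - e k t j) *\<^sub>R (P s i ** P t j)"
proof -
  have "P s i ** A k t ** P t j = P s i ** (A k t ** P t j)"
    by (simp add: matrix_mul_assoc)
  then show ?thesis
    by (simp add: matmul.diff_left matmul.diff_right P_A A_P assms matmul.scaleR_left
        matmul.scaleR_right scaleR_diff_left)
qed

text \<open>Each sum is multiplied by the resolution of the identity at the other time.\<close>

lemma sum_P_diff_sum_P:
  fixes h h' :: "'n \<Rightarrow> complex^'n^'n"
  assumes "s \<in> I" "t \<in> I"
  shows "(\<Sum>i\<in>UNIV. P s i ** h i) - (\<Sum>j\<in>UNIV. P t j ** h' j)
    = (\<Sum>i\<in>UNIV. \<Sum>j\<in>UNIV. P s i ** P t j ** (h i - h' j))"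
proof -
  have "(\<Sum>i\<in>UNIV. P s i ** h i) = (\<Sum>i\<in>UNIV. P s i ** (\<Sum>j\<in>UNIV. P t j) ** h i)"
    by (simp add: sum_P assms)
  also have "\<dots> = (\<Sum>i\<in>UNIV. \<Sum>j\<in>UNIV. P s i ** P t j ** h i)"
    by (simp add: matmul.sum_left matmul.sum_right)
  finally have 1: "(\<Sum>i\<in>UNIV. P s i ** h i) = \<dots>" .
  have "(\<Sum>j\<in>UNIV. P t j ** h' j) = (\<Sum>j\<in>UNIV. (\<Sum>i\<in>UNIV. P s i) ** P t j ** h' j)"
    by (simp add: sum_P assms)
  also have "\<dots> = (\<Sum>j\<in>UNIV. \<Sum>i\<in>UNIV. P s i ** P t j ** h' j)"
    by (simp add: matmul.sum_left)
  also have "\<dots> = (\<Sum>i\<in>UNIV. \<Sum>j\<in>UNIV. P s i ** P t j ** h' j)"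
    by (rule sum.swap)
  finally have 2: "(\<Sum>j\<in>UNIV. P t j ** h' j) = \<dots>" .
  show ?thesis
    unfolding 1 2 by (simp add: matmul.diff_right sum_subtractf)
qed

text \<open>Continuity of spectral sums although the projections may jump.  In the double sum of the
  preceding lemma a pair of nearby eigenvalues contributes little because \<open>H\<close> is continuous, and
  a pair of eigenvalues at distance more than \<open>\<surd>\<epsilon>\<close>, where \<open>\<epsilon>\<close> is the distance of the matrices,
  contributes \<open>O(\<surd>\<epsilon>)\<close> because the product of the two projections is that small.  For
  fixed \<open>i\<close> the products sum to \<open>P i\<close>, which has norm \<open>1\<close>, so once \<open>\<epsilon>\<close> is small every eigenvalue
  is near one of the limit; this keeps \<open>H\<close> bounded at the eigenvalues.\<close>

lemma tendsto_spectral_sum: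
  fixes H :: "'b \<Rightarrow> real \<Rightarrow> complex^'n^'n"
  assumes t: "t \<in> I" and \<tau>: "(\<tau> \<longlongrightarrow> t) F" "\<forall>\<^sub>F \<theta> in F. \<tau> \<theta> \<in> I"
    and H: "\<And>l j. (l \<longlongrightarrow> e k t j) F \<Longrightarrow> \<forall>\<^sub>F \<theta> in F. l \<theta> \<in> J k \<Longrightarrow>
      ((\<lambda>\<theta>. H \<theta> (l \<theta>)) \<longlongrightarrow> h (e k t j)) F"
  shows "((\<lambda>\<theta>. \<Sum>i\<in>UNIV. P (\<tau> \<theta>) i ** H \<theta> (e k (\<tau> \<theta>) i)) \<longlongrightarrow>
    (\<Sum>j\<in>UNIV. P t j ** h (e k t j))) F"
proof -
  obtain C where "0 < C \<and> (\<forall>(X :: complex^'n^'n) (Y :: complex^'n^'n). norm (X ** Y) \<le> norm X * norm Y * C)"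
    using matmul.pos_bounded by (rule exE)
  then have C: "C > 0" "\<And>(X :: complex^'n^'n) (Y :: complex^'n^'n). norm (X ** Y) \<le> norm X * norm Y * C"
    by simp_all
  define \<epsilon> where "\<epsilon> \<theta> = norm (A k (\<tau> \<theta>) - A k t)" for \<theta>
  have "((\<lambda>\<theta>. A k (\<tau> \<theta>)) \<longlongrightarrow> A k t) F"
    using continuous_on_tendsto_compose[OF cont_A \<tau>(1) t \<tau>(2)] .
  then have \<epsilon>: "(\<epsilon> \<longlongrightarrow> 0) F"
    unfolding \<epsilon>_def by (intro tendsto_norm_zero LIM_zero)
  then have sqrt_\<epsilon>: "((\<lambda>\<theta>. sqrt (\<epsilon> \<theta>)) \<longlongrightarrow> 0) F"
    using tendsto_real_sqrt[OF \<epsilon>] by simp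
  define near where "near \<theta> i j \<longleftrightarrow> \<bar>e k (\<tau> \<theta>) i - e k t j\<bar> \<le> sqrt (\<epsilon> \<theta>)" for \<theta> i j
  \<comment> \<open>Far eigenvalues are replaced by the limit, so that \<open>l i j\<close> converges and \<open>H\<close> can be applied.\<close>
  define l where "l i j \<theta> = (if near \<theta> i j then e k (\<tau> \<theta>) i else e k t j)" for i j \<theta>
  define D where "D i j \<theta> = norm (H \<theta> (l i j \<theta>) - h (e k t j))" for i j \<theta>
  have \<epsilon>0: "0 \<le> \<epsilon> \<theta>" for \<theta> by (simp add: \<epsilon>_def)
  have "((\<lambda>\<theta>. l i j \<theta> - e k t j) \<longlongrightarrow> 0) F" for i j
    by (rule Lim_null_comparison[OF _ sqrt_\<epsilon>]) (auto simp: l_def near_def \<epsilon>0)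
  then have "(l i j \<longlongrightarrow> e k t j) F" for i j
    using LIM_zero_cancel by blast
  moreover have "\<forall>\<^sub>F \<theta> in F. l i j \<theta> \<in> J k" for i j
    using \<tau>(2) by eventually_elim (auto simp: l_def e_in_J t)
  ultimately have D: "(D i j \<longlongrightarrow> 0) F" for i j
    unfolding D_def by (intro tendsto_norm_zero LIM_zero H)
  have PP: "norm (P (\<tau> \<theta>) i ** P t j) \<le> C" if "\<tau> \<theta> \<in> I" for \<theta> i j
    using C(2)[of "P (\<tau> \<theta>) i" "P t j"] that t by (simp add: norm_P)
  have far: "norm (P (\<tau> \<theta>) i ** P t j) \<le> C * C * sqrt (\<epsilon> \<theta>)"
    if \<theta>: "\<tau> \<theta> \<in> I" and "\<not> near \<theta> i j" for \<theta> i j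
  proof -
    let ?n = "norm (P (\<tau> \<theta>) i ** P t j)" and ?a = "\<bar>e k (\<tau> \<theta>) i - e k t j\<bar>"
    have "?a * ?n = norm (P (\<tau> \<theta>) i ** (A k (\<tau> \<theta>) - A k t) ** P t j)"
      by (simp add: P_diff_P \<theta> t)
    also have "\<dots> \<le> norm (P (\<tau> \<theta>) i ** (A k (\<tau> \<theta>) - A k t)) * norm (P t j) * C"
      by (rule C(2))
    also have "\<dots> \<le> norm (P (\<tau> \<theta>) i) * \<epsilon> \<theta> * C * norm (P t j) * C"
      unfolding \<epsilon>_def using C by (intro mult_right_mono) auto
    also have "\<dots> = C * C * sqrt (\<epsilon> \<theta>) * sqrt (\<epsilon> \<theta>)"
      by (simp add: norm_P \<theta> t \<epsilon>0)
    also have "\<dots> \<le> C * C * sqrt (\<epsilon> \<theta>) * ?a"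
      using that(2) C(1) \<epsilon>0 by (intro mult_left_mono) (auto simp: near_def)
    finally have "?a * ?n \<le> ?a * (C * C * sqrt (\<epsilon> \<theta>))" by (simp add: mult_ac)
    moreover have "?a > 0"
      using that(2) real_sqrt_ge_zero[OF \<epsilon>0, of \<theta>] unfolding near_def by linarith
    ultimately show ?thesis by simp
  qed
  have "((\<lambda>\<theta>. real CARD('n) * (C * C * sqrt (\<epsilon> \<theta>))) \<longlongrightarrow> 0) F"
    by (intro tendsto_mult_right_zero sqrt_\<epsilon>)
  then have "\<forall>\<^sub>F \<theta> in F. real CARD('n) * (C * C * sqrt (\<epsilon> \<theta>)) < 1"
    by (rule order_tendstoD) simp
  then have ex_near: "\<forall>\<^sub>F \<theta> in F. \<forall>i. \<exists>j. near \<theta> i j"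
    using \<tau>(2)
  proof eventually_elim
    case (elim \<theta>)
    show ?case
    proof (rule ccontr)
      assume "\<not> (\<forall>i. \<exists>j. near \<theta> i j)"
      then obtain i where i: "\<And>j. \<not> near \<theta> i j" by blast
      have "1 = norm (P (\<tau> \<theta>) i ** (\<Sum>j\<in>UNIV. P t j))"
        using elim(2) t by (simp add: sum_P norm_P)
      also have "\<dots> = norm (\<Sum>j\<in>UNIV. P (\<tau> \<theta>) i ** P t j)"
        by (simp add: matmul.sum_right)
      also have "\<dots> \<le> (\<Sum>j\<in>(UNIV :: 'n set). C * C * sqrt (\<epsilon> \<theta>))"
        by (rule sum_norm_le) (use far i elim(2) in blast)
      also have "\<dots> < 1" using elim(1) by simp
      finally show False by simp
    qed
  qed
  define h_sum where "h_sum = (\<Sum>j\<in>UNIV. norm (h (e k t j)))"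
  have h_le: "norm (h (e k t j)) \<le> h_sum" for j
    unfolding h_sum_def by (rule member_le_sum) auto
  define R where "R i j \<theta> = C * D i j \<theta> * C +
    C * C * sqrt (\<epsilon> \<theta>) * ((\<Sum>j'\<in>UNIV. D i j' \<theta>) + 2 * h_sum) * C" for i j \<theta>
  have R: "(R i j \<longlongrightarrow> 0) F" for i j
    unfolding R_def[abs_def]
    by (rule tendsto_eq_intros D sqrt_\<epsilon> refl)+ simp
  have bound: "\<forall>\<^sub>F \<theta> in F.
      norm (P (\<tau> \<theta>) i ** P t j ** (H \<theta> (e k (\<tau> \<theta>) i) - h (e k t j))) \<le> R i j \<theta>" for i j
    using \<tau>(2) ex_near
  proof eventually_elim
    case (elim \<theta>)
    let ?n = "norm (P (\<tau> \<theta>) i ** P t j)" and ?x = "norm (H \<theta> (e k (\<tau> \<theta>) i) - h (e k t j))"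
    have D0: "0 \<le> D i j' \<theta>" for j' by (simp add: D_def)
    obtain j' where "near \<theta> i j'" using elim(2) by blast
    then have "norm (H \<theta> (e k (\<tau> \<theta>) i) - h (e k t j')) = D i j' \<theta>"
      by (simp add: D_def l_def)
    also have "\<dots> \<le> (\<Sum>j'\<in>UNIV. D i j' \<theta>)"
      by (rule member_le_sum) (auto simp: D0)
    finally have x: "?x \<le> (\<Sum>j'\<in>UNIV. D i j' \<theta>) + 2 * h_sum"
      using norm_triangle_ineq[of "H \<theta> (e k (\<tau> \<theta>) i) - h (e k t j')" "h (e k t j') - h (e k t j)"]
        norm_triangle_ineq4[of "h (e k t j')" "h (e k t j)"] h_le[of j] h_le[of j']
      by simp
    have le: "norm (P (\<tau> \<theta>) i ** P t j ** (H \<theta> (e k (\<tau> \<theta>) i) - h (e k t j))) \<le> ?n * ?x * C"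
      by (rule C(2))
    have sum0: "0 \<le> (\<Sum>j'\<in>UNIV. D i j' \<theta>) + 2 * h_sum"
      unfolding h_sum_def by (intro add_nonneg_nonneg mult_nonneg_nonneg sum_nonneg D0) auto
    show ?case
    proof (cases "near \<theta> i j")
      case True
      then have "?x = D i j \<theta>" by (simp add: D_def l_def)
      then have "?n * ?x * C \<le> C * D i j \<theta> * C"
        using PP[OF elim(1)] D0 C(1) by (auto intro!: mult_right_mono)
      moreover have "0 \<le> C * C * sqrt (\<epsilon> \<theta>) * ((\<Sum>j'\<in>UNIV. D i j' \<theta>) + 2 * h_sum) * C"
        using sum0 C(1) \<epsilon>0 by (intro mult_nonneg_nonneg) auto
      ultimately show ?thesis using le unfolding R_def by linarith
    next
      case False
      have "?n * ?x * C \<le>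
          C * C * sqrt (\<epsilon> \<theta>) * ((\<Sum>j'\<in>UNIV. D i j' \<theta>) + 2 * h_sum) * C"
        using far[OF elim(1) False] x C(1) \<epsilon>0 sum0 by (intro mult_right_mono mult_mono) auto
      moreover have "0 \<le> C * D i j \<theta> * C"
        using C(1) D0 by simp
      ultimately show ?thesis using le unfolding R_def by linarith
    qed
  qed
  have "((\<lambda>\<theta>. \<Sum>i\<in>UNIV. \<Sum>j\<in>UNIV. P (\<tau> \<theta>) i ** P t j ** (H \<theta> (e k (\<tau> \<theta>) i) - h (e k t j)))
      \<longlongrightarrow> 0) F"
    by (intro tendsto_null_sum Lim_null_comparison[OF bound R])
  moreover have "\<forall>\<^sub>F \<theta> in F.
      (\<Sum>i\<in>UNIV. \<Sum>j\<in>UNIV. P (\<tau> \<theta>) i ** P t j ** (H \<theta> (e k (\<tau> \<theta>) i) - h (e k t j))) =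
      (\<Sum>i\<in>UNIV. P (\<tau> \<theta>) i ** H \<theta> (e k (\<tau> \<theta>) i)) - (\<Sum>j\<in>UNIV. P t j ** h (e k t j))"
    using \<tau>(2) by eventually_elim (simp add: sum_P_diff_sum_P t)
  ultimately have "((\<lambda>\<theta>. (\<Sum>i\<in>UNIV. P (\<tau> \<theta>) i ** H \<theta> (e k (\<tau> \<theta>) i)) -
      (\<Sum>j\<in>UNIV. P t j ** h (e k t j))) \<longlongrightarrow> 0) F"
    by (rule Lim_transform_eventually)
  then show ?thesis by (rule LIM_zero_cancel)
qed

abbreviation word_at :: "(('b \<Rightarrow> (complex^'n^'n)) \<times> ('b \<Rightarrow> real) \<times> nat) list \<Rightarrow> 'b \<Rightarrow>
    ((complex^'n^'n) \<times> real \<times> nat) list" where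
  "word_at w \<theta> \<equiv> map (\<lambda>(M, \<tau>, k). (M \<theta>, \<tau> \<theta>, k)) w"

fun letter_tendsto :: "'b filter \<Rightarrow> ('b \<Rightarrow> complex^'n^'n) \<times> ('b \<Rightarrow> real) \<times> nat \<Rightarrow>
    (complex^'n^'n) \<times> real \<times> nat \<Rightarrow> bool" where
  "letter_tendsto F (M, \<tau>, k) (M0, t, k0) \<longleftrightarrow> (M \<longlongrightarrow> M0) F \<and> t \<in> I \<and> (\<tau> \<longlongrightarrow> t) F \<and>
    (\<forall>\<^sub>F \<theta> in F. \<tau> \<theta> \<in> I) \<and> k0 = k"

text \<open>The base point \<open>z\<close> has to vary along the filter as well, because the induction substitutes the
  moving eigenvalues of the first letter into it.\<close>

lemma tendsto_operator_integral:
  assumes g: "continuous_on (Pi UNIV J) g"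
    and "list_all2 (letter_tendsto F) w w0"
    and "\<And>k. ((\<lambda>\<theta>. z \<theta> k) \<longlongrightarrow> z0 k) F" "\<forall>\<^sub>F \<theta> in F. z \<theta> \<in> Pi UNIV J" "z0 \<in> Pi UNIV J"
  shows "((\<lambda>\<theta>. operator_integral g (z \<theta>) (word_at w \<theta>)) \<longlongrightarrow> operator_integral g z0 w0) F"
  using assms(2-)
proof (induction w w0 arbitrary: z z0 rule: list_all2_induct)
  case Nil
  have "((\<lambda>\<theta>. g (z \<theta>)) \<longlongrightarrow> g z0) F"
    using continuous_on_tendsto_compose[OF g tendsto_fun_coordinatewise] Nil by blast
  then show ?case by (auto intro!: tendsto_intros)
next
  case (Cons l w l0 w0)
  obtain M \<tau> k M0 t where l: "l = (M, \<tau>, k)" "l0 = (M0, t, k)"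
    and M: "(M \<longlongrightarrow> M0) F" and t: "t \<in> I" and \<tau>: "(\<tau> \<longlongrightarrow> t) F" "\<forall>\<^sub>F \<theta> in F. \<tau> \<theta> \<in> I"
    using Cons.hyps(1) by (cases l; cases l0) auto
  have "((\<lambda>\<theta>. \<Sum>i\<in>UNIV. P (\<tau> \<theta>) i **
        operator_integral g ((z \<theta>)(k := e k (\<tau> \<theta>) i)) (word_at w \<theta>)) \<longlongrightarrow>
      (\<Sum>j\<in>UNIV. P t j ** operator_integral g (z0(k := e k t j)) w0)) F"
  proof (rule tendsto_spectral_sum[OF t \<tau>,
        where H = "\<lambda>\<theta> r. operator_integral g ((z \<theta>)(k := r)) (word_at w \<theta>)"
          and h = "\<lambda>r. operator_integral g (z0(k := r)) w0"])
    fix r j assume r: "(r \<longlongrightarrow> e k t j) F" "\<forall>\<^sub>F \<theta> in F. r \<theta> \<in> J k"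
    show "((\<lambda>\<theta>. operator_integral g ((z \<theta>)(k := r \<theta>)) (word_at w \<theta>)) \<longlongrightarrow>
        operator_integral g (z0(k := e k t j)) w0) F"
    proof (rule Cons.IH)
      show "((\<lambda>\<theta>. ((z \<theta>)(k := r \<theta>)) k') \<longlongrightarrow> (z0(k := e k t j)) k') F" for k'
        using r(1) Cons.prems(1) by (cases "k' = k") auto
      show "\<forall>\<^sub>F \<theta> in F. (z \<theta>)(k := r \<theta>) \<in> Pi UNIV J"
        using Cons.prems(2) r(2) by eventually_elim (rule upd_in_box)
      show "z0(k := e k t j) \<in> Pi UNIV J"
        using Cons.prems(3) t by (rule e_upd_in_box)
    qed
  qed
  then show ?case using matmul.tendsto[OF M] by (simp add: l)
qed

text \<open>Operator integrals are linear in the symbol.  The variables \<open>k\<close> and \<open>d\<close> must not occur in the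
  word, whose letters would overwrite them.\<close>

lemma operator_integral_upd_diff:
  assumes g1: "\<And>z a b. z \<in> Pi UNIV J \<Longrightarrow> a \<in> J k \<Longrightarrow> b \<in> J k \<Longrightarrow>
      g (z(k := a)) - g (z(k := b)) = (a - b) * g1 (z(k := a, d := b))"
    and "z \<in> Pi UNIV J" "a \<in> J k" "b \<in> J k"
    and "\<And>M \<tau> q. (M, \<tau>, q) \<in> set w \<Longrightarrow> \<tau> \<in> I \<and> q \<noteq> k \<and> q \<noteq> d"
  shows "operator_integral g (z(k := a)) w - operator_integral g (z(k := b)) w =
    (a - b) *\<^sub>R operator_integral g1 (z(k := a, d := b)) w"
  using assms(2,5)
proof (induction w arbitrary: z)
  case Nil
  then show ?case using g1[of z a b] assms(3,4) by (simp add: fun_upd_def flip: scaleR_diff_left)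
next
  case (Cons l w)
  obtain M \<tau> q where l: "l = (M, \<tau>, q)" by (cases l)
  have \<tau>: "\<tau> \<in> I" and q: "q \<noteq> k" "q \<noteq> d" using Cons.prems(2) by (auto simp: l)
  have w: "\<tau> \<in> I \<and> q \<noteq> k \<and> q \<noteq> d" if "(M, \<tau>, q) \<in> set w" for M \<tau> q
    using that Cons.prems(2)[of M \<tau> q] by simp
  have diff: "operator_integral g (z(k := a, q := e q \<tau> i)) w -
      operator_integral g (z(k := b, q := e q \<tau> i)) w
      = (a - b) *\<^sub>R operator_integral g1 (z(k := a, d := b, q := e q \<tau> i)) w" for i
  proof -
    have upd: "z(k := c, q := e q \<tau> i) = z(q := e q \<tau> i, k := c)"
      "z(k := a, d := b, q := e q \<tau> i) = z(q := e q \<tau> i, k := a, d := b)" for c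
      using q by auto
    show ?thesis
      unfolding upd
      by (rule Cons.IH[OF e_upd_in_box[OF Cons.prems(1) \<tau>]]) (use w in blast)
  qed
  then show ?case
    by (simp only: l operator_integral.simps diff matmul.scaleR_right
        flip: matmul.diff_right scaleR_sum_right sum_subtractf)
qed

text \<open>The divided difference releases a factor, the difference of two eigenvalues at the times \<open>s\<close>
  and \<open>t\<close>, and by \<open>P_diff_P\<close> this factor becomes the increment of the curve between the two
  projections.\<close>

lemma spectral_sum_time_diff:
  assumes g1: "\<And>z a b. z \<in> Pi UNIV J \<Longrightarrow> a \<in> J k \<Longrightarrow> b \<in> J k \<Longrightarrow>
      g (z(k := a)) - g (z(k := b)) = (a - b) * g1 (z(k := a, d := b))"
    and z: "z \<in> Pi UNIV J" and d: "e d = e k"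
    and w: "\<And>M \<tau> q. (M, \<tau>, q) \<in> set w \<Longrightarrow> \<tau> \<in> I \<and> q \<noteq> k \<and> q \<noteq> d"
    and s: "s \<in> I" and t: "t \<in> I"
  shows "(\<Sum>i\<in>UNIV. P s i ** operator_integral g (z(k := e k s i)) w) -
      (\<Sum>j\<in>UNIV. P t j ** operator_integral g (z(k := e k t j)) w) =
    operator_integral g1 z ((mat 1, s, k) # (A k s - A k t, t, d) # w)" (is "?l = _")
proof -
  have "?l = (\<Sum>i\<in>UNIV. \<Sum>j\<in>UNIV. P s i ** P t j **
      (operator_integral g (z(k := e k s i)) w - operator_integral g (z(k := e k t j)) w))"
    by (rule sum_P_diff_sum_P[OF s t])
  also have "\<dots> = (\<Sum>i\<in>UNIV. \<Sum>j\<in>UNIV. ((e k s i - e k t j) *\<^sub>R (P s i ** P t j)) **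
      operator_integral g1 (z(k := e k s i, d := e k t j)) w)"
    by (simp add: operator_integral_upd_diff[OF g1 z e_in_J[OF s] e_in_J[OF t] w]
        matmul.scaleR_left matmul.scaleR_right)
  also have "\<dots> = (\<Sum>i\<in>UNIV. P s i ** ((A k s - A k t) ** (\<Sum>j\<in>UNIV. P t j **
      operator_integral g1 (z(k := e k s i, d := e k t j)) w)))"
    by (simp add: matmul.sum_right matrix_mul_assoc flip: P_diff_P[OF s t])
  finally show ?thesis by (simp add: d)
qed

definition curve_integral ::
  "((nat \<Rightarrow> real) \<Rightarrow> real) \<Rightarrow> (nat \<Rightarrow> real) \<Rightarrow> ((real \<Rightarrow> complex^'n^'n) \<times> nat) list \<Rightarrow> real \<Rightarrow>
    complex^'n^'n" where
  "curve_integral g z w t = operator_integral g z (map (\<lambda>(B, k). (B t, t, k)) w)"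

text \<open>Variables from \<open>N\<close> on do not occur, hence are available as second nodes of divided
  differences.\<close>

definition admissible ::
  "nat \<Rightarrow> nat \<Rightarrow> ((nat \<Rightarrow> real) \<Rightarrow> real) \<Rightarrow> ((real \<Rightarrow> complex^'n^'n) \<times> nat) list \<Rightarrow> bool" where
  "admissible m N g w \<longleftrightarrow> smooth_on_box m J g \<and> (\<forall>k\<ge>N. independent_of J k g) \<and>
    distinct (map snd w) \<and> (\<forall>(B, k)\<in>set w. k < N \<and> smooth_curve m I B)"

lemma curve_integral_Nil: "curve_integral g z [] t = g z *\<^sub>R mat 1"
  by (simp add: curve_integral_def)

lemma curve_integral_Cons: "curve_integral g z ((B, k) # w) t =
    B t ** (\<Sum>i\<in>UNIV. P t i ** curve_integral g (z(k := e k t i)) w t)"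
  by (simp add: curve_integral_def)

lemma curve_letters_tendsto:
  assumes "\<forall>l\<in>set w. continuous_on I (fst l)" "t \<in> I"
  shows "list_all2 (letter_tendsto (at t within I)) (map (\<lambda>(B, k). (B, \<lambda>s. s, k)) w)
    (map (\<lambda>(B, k). (B t, t, k)) w)"
  using assms
  by (induction w) (auto simp: eventually_at_filter continuous_on_def)

lemma curve_integral_continuous:
  assumes g: "smooth_on_box m J g" and w: "\<forall>(B, k)\<in>set w. smooth_curve m I B"
    and z: "z \<in> Pi UNIV J"
  shows "continuous_on I (curve_integral g z w)"
  unfolding continuous_on_def
proof
  fix t assume t: "t \<in> I"
  let ?w = "map (\<lambda>(B, k). (B, \<lambda>s. s, k)) w"
  have "list_all2 (letter_tendsto (at t within I)) ?w (map (\<lambda>(B, k). (B t, t, k)) w)"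
    using w t by (intro curve_letters_tendsto) (fastforce intro: smooth_curve_continuous)+
  then have "((\<lambda>s. operator_integral g z (word_at ?w s)) \<longlongrightarrow> curve_integral g z w t) (at t within I)"
    unfolding curve_integral_def
    by (intro tendsto_operator_integral smooth_on_box_continuous[OF g]) (use z in auto)
  also have "(\<lambda>s. operator_integral g z (word_at ?w s)) = curve_integral g z w"
    by (simp add: curve_integral_def fun_eq_iff case_prod_unfold o_def)
  finally show "(curve_integral g z w \<longlongrightarrow> curve_integral g z w t) (at t within I)" .
qed

lemma sum_list_curve_integral_Cons:
  "(\<Sum>(g', w')\<leftarrow>map (\<lambda>(g', w'). (g', (B, k) # w')) L. curve_integral g' z w' t) =
    B t ** (\<Sum>i\<in>UNIV. P t i ** (\<Sum>(g', w')\<leftarrow>L. curve_integral g' (z(k := e k t i)) w' t))"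
  by (induction L)
    (auto simp: curve_integral_Cons matmul.add_right sum.distrib matmul.zero_right fun_upd_def)

text \<open>The product rule.  For the first letter there are three contributions: the derivative of
  the remaining word, the derivative of the matrix curve, and, from the spectral data, a longer
  word with the divided difference as symbol and the derivative of \<open>A k\<close> as a new letter.  The
  bound on the variables of the new words ensures that the first letter can be put in front of
  the words for the remaining word without repeating a variable.\<close>

lemma curve_integral_has_derivative:
  assumes A': "\<And>k. smooth_curve (Suc m) I (A k)"
    and "admissible (Suc m) N g w"
  shows "\<exists>L. (\<forall>(g', w')\<in>set L. (\<exists>N'\<ge>N. admissible m N' g' w') \<and>
      snd ` set w' \<subseteq> snd ` set w \<union> {N..}) \<and>
    (\<forall>z\<in>Pi UNIV J. \<forall>t\<in>I. (curve_integral g z w has_vector_derivative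
      (\<Sum>(g', w')\<leftarrow>L. curve_integral g' z w' t)) (at t within I))"
  using assms(2)
proof (induction w)
  case Nil
  show ?case by (intro exI[of _ "[]"]) (auto simp: curve_integral_Nil[abs_def])
next
  case (Cons l w)
  obtain B k where l: "l = (B, k)" by (cases l)
  have g: "smooth_on_box (Suc m) J g" and ind: "\<And>k. N \<le> k \<Longrightarrow> independent_of J k g"
    and k: "k < N" "k \<notin> snd ` set w" and B: "smooth_curve (Suc m) I B"
    and w: "distinct (map snd w)" "\<And>B q. (B, q) \<in> set w \<Longrightarrow> q < N"
      "\<And>B q. (B, q) \<in> set w \<Longrightarrow> smooth_curve (Suc m) I B"
    using Cons.prems by (auto simp: admissible_def l)
  have w': "smooth_curve m I B" if "(B, q) \<in> set w" for B q
    using w(3)[OF that] by (rule smooth_curve_Suc_imp)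
  have "admissible (Suc m) N g w" using Cons.prems by (auto simp: admissible_def)
  from Cons.IH[OF this] obtain L where
    L: "\<And>g' w'. (g', w') \<in> set L \<Longrightarrow> (\<exists>N'\<ge>N. admissible m N' g' w') \<and>
      snd ` set w' \<subseteq> snd ` set w \<union> {N..}"
    and der: "\<And>z t. z \<in> Pi UNIV J \<Longrightarrow> t \<in> I \<Longrightarrow> (curve_integral g z w has_vector_derivative
      (\<Sum>(g', w')\<leftarrow>L. curve_integral g' z w' t)) (at t within I)"
    by fast
  obtain B' where B': "\<And>t. t \<in> I \<Longrightarrow> (B has_vector_derivative B' t) (at t within I)"
    "smooth_curve m I B'"
    using B by fastforce
  obtain A' where A': "\<And>t. t \<in> I \<Longrightarrow> (A k has_vector_derivative A' t) (at t within I)"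
    "smooth_curve m I A'"
    using A'[of k] by fastforce
  obtain d where d: "N \<le> d" "A d = A k" "e d = e k" "J d = J k"
    using fresh by blast
  have "k \<noteq> d" using d k by simp
  obtain g1 where g1: "smooth_on_box m J g1" "\<And>q. d < q \<Longrightarrow> independent_of J q g1"
    "\<And>z a b. z \<in> Pi UNIV J \<Longrightarrow> a \<in> J k \<Longrightarrow> b \<in> J k \<Longrightarrow>
      g (z(k := a)) - g (z(k := b)) = (a - b) * g1 (z(k := a, d := b))"
    using smooth_divided_difference[OF open_J convex_J d(4) \<open>k \<noteq> d\<close> g ind k(1) d(1)] by blast
  define L' where "L' = map (\<lambda>(g', w'). (g', (B, k) # w')) L @
    [(g, (B', k) # w), (g1, (B, k) # (A', d) # w)]"
  have "(\<exists>N'\<ge>N. admissible m N' g' w') \<and> snd ` set w' \<subseteq> snd ` set (l # w) \<union> {N..}"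
    if mem: "(g', w') \<in> set L'" for g' w'
  proof -
    consider w'' where "(g', w'') \<in> set L" "w' = (B, k) # w''"
      | "g' = g" "w' = (B', k) # w" | "g' = g1" "w' = (B, k) # (A', d) # w"
      using mem by (auto simp: L'_def)
    then show ?thesis
    proof cases
      case 1
      obtain N' where N': "N \<le> N'" "admissible m N' g' w''" and sub: "snd ` set w'' \<subseteq> snd ` set w \<union> {N..}"
        using L[OF 1(1)] by blast
      have "k \<notin> snd ` set w''" using sub k by auto
      then have "admissible m N' g' w'"
        using N' k(1) smooth_curve_Suc_imp[OF B] by (auto simp: admissible_def 1(2))
      then show ?thesis using N'(1) sub by (auto simp: 1(2) l)
    next
      case 2
      have "admissible m N g' w'"
        using smooth_on_box_Suc_imp[OF g] ind k B'(2) w w' by (auto simp: admissible_def 2)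
      then show ?thesis by (auto simp: 2 l)
    next
      case 3
      have "d \<notin> snd ` set w" using w(2) d(1) by fastforce
      moreover have "q < Suc d" if "(C, q) \<in> set w" for C q
        using w(2)[OF that] d(1) by simp
      ultimately have "admissible m (Suc d) g' w'"
        using g1 k d(1) smooth_curve_Suc_imp[OF B] A'(2) w(1) w'
        by (auto simp: admissible_def 3)
      then show ?thesis using d(1) by (auto simp: 3 l intro!: exI[of _ "Suc d"])
    qed
  qed
  moreover have "(curve_integral g z (l # w) has_vector_derivative
      (\<Sum>(g', w')\<leftarrow>L'. curve_integral g' z w' t)) (at t within I)"
    if z: "z \<in> Pi UNIV J" and t: "t \<in> I" for z t
  proof -
    let ?F = "at t within I" and ?c = "\<lambda>s. 1 / (s - t)"
    let ?W = "\<lambda>s. map (\<lambda>(B, k). (B s, s, k)) w"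
    let ?w = "map (\<lambda>(B, k). (B, \<lambda>s. s, k)) w"
    have inI: "\<forall>\<^sub>F s in ?F. s \<in> I" by (simp add: eventually_at_filter)
    have "\<forall>l\<in>set w. continuous_on I (fst l)"
      using w(3) smooth_curve_continuous by (metis prod.collapse)
    then have tail: "list_all2 (letter_tendsto ?F) ?w (?W t)"
      using t by (rule curve_letters_tendsto)
    \<comment> \<open>The difference quotient, split into the contributions of \<open>B\<close>, of the spectral data of the
      first letter, and of the remaining word.  The second is a mixed integral, with letters at both
      times \<open>s\<close> and \<open>t\<close>.\<close>
    define X1 where "X1 s = operator_integral g z ((?c s *\<^sub>R (B s - B t), s, k) # ?W s)" for s
    define X2 where
      "X2 s = operator_integral g1 z ((B t, s, k) # (?c s *\<^sub>R (A k s - A k t), t, d) # ?W s)" for s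
    define X3 where "X3 s = B t ** (\<Sum>j\<in>UNIV. P t j ** (?c s *\<^sub>R
      (curve_integral g (z(k := e k t j)) w s - curve_integral g (z(k := e k t j)) w t)))" for s
    have "(X1 \<longlongrightarrow> curve_integral g z ((B', k) # w) t) ?F"
      using tendsto_operator_integral[OF smooth_on_box_continuous[OF g],
          where F = ?F and w = "(\<lambda>s. ?c s *\<^sub>R (B s - B t), \<lambda>s. s, k) # ?w" and z = "\<lambda>_. z"
            and ?z0.0 = z and ?w0.0 = "(B' t, t, k) # ?W t"]
        B'(1)[OF t] tail t z inI
      by (simp add: X1_def[abs_def] curve_integral_def has_vector_derivative_within_quotient
          case_prod_unfold o_def)
    moreover have "(X2 \<longlongrightarrow> curve_integral g1 z ((B, k) # (A', d) # w) t) ?F"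
      using tendsto_operator_integral[OF smooth_on_box_continuous[OF g1(1)],
          where F = ?F and w = "(\<lambda>s. B t, \<lambda>s. s, k) # (\<lambda>s. ?c s *\<^sub>R (A k s - A k t), \<lambda>s. t, d) # ?w"
            and z = "\<lambda>_. z" and ?z0.0 = z and ?w0.0 = "(B t, t, k) # (A' t, t, d) # ?W t"]
        A'(1)[OF t] tail t z inI
      by (simp add: X2_def[abs_def] curve_integral_def has_vector_derivative_within_quotient
          case_prod_unfold o_def)
    moreover have "(X3 \<longlongrightarrow> B t ** (\<Sum>j\<in>UNIV. P t j **
        (\<Sum>(g', w')\<leftarrow>L. curve_integral g' (z(k := e k t j)) w' t))) ?F"
      unfolding X3_def
      by (intro matmul.tendsto tendsto_const tendsto_sum)
        (use der[OF e_upd_in_box[OF z t] t] has_vector_derivative_within_quotient in blast)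
    ultimately have "((\<lambda>s. X1 s + X2 s + X3 s) \<longlongrightarrow>
        (\<Sum>(g', w')\<leftarrow>L'. curve_integral g' z w' t)) ?F"
      unfolding L'_def map_append sum_list_append sum_list_curve_integral_Cons
      by (auto intro!: tendsto_eq_intros)
    moreover have "\<forall>\<^sub>F s in ?F. X1 s + X2 s + X3 s =
        ?c s *\<^sub>R (curve_integral g z (l # w) s - curve_integral g z (l # w) t)"
      using inI
    proof eventually_elim
      case (elim s)
      define Y where "Y = (\<lambda>r. \<Sum>i\<in>UNIV. P r i ** curve_integral g (z(k := e k r i)) w s)"
      have letters: "\<tau> \<in> I \<and> q \<noteq> k \<and> q \<noteq> d" if mem: "(M, \<tau>, q) \<in> set (?W s)" for M \<tau> q
      proof -
        obtain C where C: "(C, q) \<in> set w" "\<tau> = s" using mem by auto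
        then have "q \<in> snd ` set w" by force
        then show ?thesis using C elim k(2) w(2)[OF C(1)] d(1) by auto
      qed
      have "Y s - Y t = operator_integral g1 z ((mat 1, s, k) # (A k s - A k t, t, d) # ?W s)"
        unfolding Y_def curve_integral_def
        by (rule spectral_sum_time_diff[OF g1(3) z d(3) letters elim t])
      then have X2: "X2 s = ?c s *\<^sub>R (B t ** (Y s - Y t))"
        by (simp add: X2_def matmul.scaleR_left matmul.scaleR_right flip: scaleR_sum_right)
      have X1: "X1 s = ?c s *\<^sub>R ((B s - B t) ** Y s)"
        by (simp add: X1_def Y_def curve_integral_def matmul.scaleR_left)
      have "X3 s = ?c s *\<^sub>R (B t ** (Y t - (\<Sum>j\<in>UNIV. P t j ** curve_integral g (z(k := e k t j)) w t)))"
        by (simp add: X3_def Y_def matmul.scaleR_right matmul.diff_right sum_subtractf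
            flip: scaleR_sum_right)
      then show ?case
        unfolding X1 X2 l curve_integral_Cons
        by (simp add: Y_def[symmetric] matmul.diff_left matmul.diff_right
            flip: scaleR_add_right) (simp add: Y_def)
    qed
    ultimately show ?thesis
      unfolding has_vector_derivative_within_quotient by (rule Lim_transform_eventually)
  qed
  ultimately show ?case by (intro exI[of _ L']) auto
qed

lemma curve_integral_smooth:
  assumes "\<And>k. smooth_curve m I (A k)" "admissible m N g w" "z \<in> Pi UNIV J"
  shows "smooth_curve m I (curve_integral g z w)"
  using assms
proof (induction m arbitrary: g w N)
  case 0
  then have g: "smooth_on_box 0 J g" and w: "\<forall>(B, k)\<in>set w. smooth_curve 0 I B"
    unfolding admissible_def by blast+
  show ?case using curve_integral_continuous[OF g w 0(3)] by simp
next
  case (Suc m)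
  obtain L where L: "\<forall>(g', w')\<in>set L. (\<exists>N'\<ge>N. admissible m N' g' w') \<and>
      snd ` set w' \<subseteq> snd ` set w \<union> {N..}"
    and der: "\<forall>z\<in>Pi UNIV J. \<forall>t\<in>I. (curve_integral g z w has_vector_derivative
      (\<Sum>(g', w')\<leftarrow>L. curve_integral g' z w' t)) (at t within I)"
    using curve_integral_has_derivative[OF Suc.prems(1,2)] by blast
  have "smooth_curve m I (\<lambda>t. \<Sum>(g', w')\<leftarrow>L. curve_integral g' z w' t)"
    unfolding case_prod_unfold
  proof (rule smooth_curve_sum_list)
    fix x assume "x \<in> set L"
    then obtain N' where "admissible m N' (fst x) (snd x)" using L by fastforce
    then show "smooth_curve m I (curve_integral (fst x) z (snd x))"
      using Suc.IH smooth_curve_Suc_imp[OF Suc.prems(1)] Suc.prems(3) by blast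
  qed
  then show ?case
    using der Suc.prems(3)
    by (auto intro!: exI[of _ "\<lambda>t. \<Sum>(g', w')\<leftarrow>L. curve_integral g' z w' t"])
qed

end

section \<open>Spectral projections of a diagonalization\<close>

definition spectral_projection :: "complex^'n^'n \<Rightarrow> 'n \<Rightarrow> complex^'n^'n" where
  "spectral_projection U i = (\<chi> a b. U $ a $ i * cnj (U $ b $ i))"

lemma diagonalization_eq_sum:
  "U ** diag_matrix d ** conj_transpose U = (\<Sum>i\<in>UNIV. d i *\<^sub>R spectral_projection U i)"
  unfolding vec_eq_iff
proof (intro allI)
  fix a b
  have "(U ** diag_matrix d ** conj_transpose U) $ a $ b
      = (\<Sum>i\<in>UNIV. (U ** diag_matrix d) $ a $ i * cnj (U $ b $ i))"
    by (simp add: matrix_matrix_mult_def[of "U ** diag_matrix d"] conj_transpose_def)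
  also have "\<dots> = (\<Sum>i\<in>UNIV. d i *\<^sub>R (U $ a $ i * cnj (U $ b $ i)))"
    by (simp add: matrix_mult_diag_right scaleR_conv_of_real mult_ac)
  finally show "(U ** diag_matrix d ** conj_transpose U) $ a $ b
      = (\<Sum>i\<in>UNIV. d i *\<^sub>R spectral_projection U i) $ a $ b"
    by (simp add: spectral_projection_def)
qed

lemma unitary_columns:
  assumes "unitary U"
  shows "(\<Sum>a\<in>UNIV. cnj (U $ a $ i) * U $ a $ j) = (if i = j then 1 else 0)"
proof -
  have "(conj_transpose U ** U) $ i $ j = mat 1 $ i $ j"
    using assms by (simp add: unitary_def)
  then show ?thesis by (simp add: matrix_matrix_mult_def conj_transpose_def mat_def)
qed

lemma spectral_projection_mult:
  assumes "unitary U"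
  shows "spectral_projection U i ** spectral_projection U j =
    (if i = j then spectral_projection U i else 0)"
proof -
  have "(spectral_projection U i ** spectral_projection U j) $ a $ b =
      U $ a $ i * cnj (U $ b $ j) * (\<Sum>c\<in>UNIV. cnj (U $ c $ i) * U $ c $ j)" for a b
    by (simp add: spectral_projection_def matrix_matrix_mult_def sum_distrib_left mult_ac)
  then show ?thesis
    by (simp add: vec_eq_iff unitary_columns[OF assms] spectral_projection_def)
qed

lemma sum_spectral_projection:
  fixes U :: "complex^'n^'n"
  assumes "unitary U"
  shows "(\<Sum>i\<in>UNIV. spectral_projection U i) = mat 1"
proof -
  have "diag_matrix (\<lambda>i. 1) = (mat 1 :: complex^'n^'n)"
    by (simp add: diag_matrix_def mat_def vec_eq_iff)
  then show ?thesis
    using diagonalization_eq_sum[of U "\<lambda>i. 1"] assms by (simp add: unitary_def)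
qed

lemma norm_spectral_projection:
  assumes "unitary U"
  shows "norm (spectral_projection U i) = 1"
proof -
  have "complex_of_real (\<Sum>a\<in>UNIV. (cmod (U $ a $ i))\<^sup>2) = 1"
    using unitary_columns[OF assms, of i i] by (simp add: mult.commute flip: complex_norm_square)
  then have 1: "(\<Sum>a\<in>UNIV. (cmod (U $ a $ i))\<^sup>2) = 1"
    using of_real_eq_1_iff by blast
  have "(norm (spectral_projection U i))\<^sup>2
      = (\<Sum>a\<in>UNIV. \<Sum>b\<in>UNIV. (cmod (U $ a $ i))\<^sup>2 * (cmod (U $ b $ i))\<^sup>2)"
    by (simp add: spectral_projection_def norm_vec_def L2_set_def sum_nonneg norm_mult
        power_mult_distrib)
  also have "\<dots> = 1"
    by (simp add: 1 flip: sum_distrib_left)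
  finally show ?thesis
    using norm_ge_zero[of "spectral_projection U i"] unfolding power2_eq_1_iff by linarith
qed

lemma
  assumes "unitary U"
  shows spectral_projection_mult_diagonalization:
      "spectral_projection U i ** (U ** diag_matrix d ** conj_transpose U) =
        d i *\<^sub>R spectral_projection U i"
    and diagonalization_mult_spectral_projection:
      "(U ** diag_matrix d ** conj_transpose U) ** spectral_projection U i =
        d i *\<^sub>R spectral_projection U i"
  unfolding diagonalization_eq_sum
  by (simp_all add: matmul.sum_right matmul.sum_left matmul.scaleR_right matmul.scaleR_left
      spectral_projection_mult[OF assms] if_distrib cong: if_cong)

section \<open>Transfer to iterated derivatives\<close>

lemma C_two_vars_on_imp_smooth_on_box:
  assumes "C_two_vars_on m (J1 \<times> J2) f" "J 0 = J1" "J (Suc 0) = J2"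
  shows "smooth_on_box m J (\<lambda>z. f (z 0, z (Suc 0)))"
  using assms(1)
proof (induction m arbitrary: f)
  case (0 f)
  have coord: "continuous_on (Pi UNIV J) (\<lambda>z. z k)" for k
    by (rule continuous_on_product_then_coordinatewise[OF continuous_on_id])
  have "continuous_on (Pi UNIV J) (\<lambda>z. f (z 0, z (Suc 0)))"
    by (rule continuous_on_compose2[of "J1 \<times> J2" f])
      (use 0 assms(2,3) in \<open>auto intro!: continuous_on_Pair coord simp: Pi_iff\<close>)
  then show ?case by simp
next
  case (Suc m)
  obtain f1 f2 where
    f1: "\<forall>(x, y)\<in>J1 \<times> J2. ((\<lambda>s. f (s, y)) has_real_derivative f1 (x, y)) (at x)"
    and f2: "\<forall>(x, y)\<in>J1 \<times> J2. ((\<lambda>s. f (x, s)) has_real_derivative f2 (x, y)) (at y)"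
    and C: "C_two_vars_on m (J1 \<times> J2) f1" "C_two_vars_on m (J1 \<times> J2) f2"
    using Suc.prems by auto
  have coord: "continuous_on (Pi UNIV J) (\<lambda>z. z k)" for k
    by (rule continuous_on_product_then_coordinatewise[OF continuous_on_id])
  have "continuous_on (Pi UNIV J) (\<lambda>z. f (z 0, z (Suc 0)))"
    by (rule continuous_on_compose2[of "J1 \<times> J2" f])
      (use Suc.prems assms(2,3) in \<open>auto intro!: continuous_on_Pair coord simp: Pi_iff\<close>)
  moreover have "\<exists>g'. (\<forall>z\<in>Pi UNIV J. ((\<lambda>s. f ((z(q := s)) 0, (z(q := s)) (Suc 0)))
      has_real_derivative g' z) (at (z q))) \<and> smooth_on_box m J g'" for q
  proof -
    have z: "(z 0, z (Suc 0)) \<in> J1 \<times> J2" if "z \<in> Pi UNIV J" for z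
      using that assms(2,3) by auto
    consider "q = 0" | "q = Suc 0" | "q \<noteq> 0" "q \<noteq> Suc 0" by blast
    then show ?thesis
    proof cases
      case 1
      then show ?thesis
        using f1 z Suc.IH[OF C(1)] by (intro exI[of _ "\<lambda>z. f1 (z 0, z (Suc 0))"]) fastforce
    next
      case 2
      then show ?thesis
        using f2 z Suc.IH[OF C(2)] by (intro exI[of _ "\<lambda>z. f2 (z 0, z (Suc 0))"]) fastforce
    next
      case 3
      then show ?thesis
        by (intro exI[of _ "\<lambda>z. 0"]) (simp add: smooth_on_box_zero)
    qed
  qed
  ultimately show ?case by simp
qed

lemma nth_derivative_shift: "nth_derivative l (nth_derivative 1 c I) I = nth_derivative (Suc l) c I"
  by (induction l) auto

lemma C_curve_on_imp_smooth_curve: "C_curve_on m c I \<Longrightarrow> smooth_curve m I c"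
proof (induction m arbitrary: c)
  case 0
  then show ?case by (simp add: C_curve_on_def)
next
  case (Suc m)
  let ?c = "nth_derivative 1 c I"
  have "C_curve_on m ?c I"
    using Suc.prems unfolding C_curve_on_def times_differentiable_on_def nth_derivative_shift
    by auto
  moreover have "c differentiable_on I"
    using Suc.prems unfolding C_curve_on_def times_differentiable_on_def
    by (metis nth_derivative.simps(1) zero_less_Suc)
  then have "\<forall>t\<in>I. (c has_vector_derivative ?c t) (at t within I)"
    by (simp add: differentiable_on_def flip: vector_derivative_works)
  ultimately show ?case using Suc.IH by auto
qed

lemma smooth_curve_bounded_linear:
  assumes "bounded_linear h"
  shows "smooth_curve m I c \<Longrightarrow> smooth_curve m I (\<lambda>t. h (c t))"
proof (induction m arbitrary: c)
  case 0
  then show ?case using bounded_linear.continuous_on[OF assms] by simp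
next
  case (Suc m)
  then obtain c' where "\<forall>t\<in>I. (c has_vector_derivative c' t) (at t within I)"
    "smooth_curve m I c'"
    by auto
  then show ?case
    using Suc.IH bounded_linear.has_vector_derivative[OF assms]
    by (auto intro!: exI[of _ "\<lambda>t. h (c' t)"])
qed

lemma smooth_curve_cong:
  assumes "\<And>t. t \<in> I \<Longrightarrow> b t = c t" "smooth_curve m I b"
  shows "smooth_curve m I c"
proof (cases m)
  case 0
  then show ?thesis using assms by (simp cong: continuous_on_cong)
next
  case (Suc k)
  obtain c' where "\<forall>t\<in>I. (b has_vector_derivative c' t) (at t within I)" "smooth_curve k I c'"
    using assms(2) unfolding Suc by auto
  then have "\<forall>t\<in>I. (c has_vector_derivative c' t) (at t within I)" "smooth_curve k I c'"
    using assms(1) has_vector_derivative_transform[of _ I c b] by simp_all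
  then show ?thesis unfolding Suc by auto
qed

text \<open>Where the derivative within \<open>I\<close> is unique, \<open>vector_derivative\<close> must agree with the
  derivative that witnesses smoothness.\<close>

lemma smooth_curve_nth_derivative:
  assumes nontriv: "\<And>t. t \<in> I \<Longrightarrow> at t within I \<noteq> bot"
  shows "smooth_curve (l + k) I c \<Longrightarrow> smooth_curve k I (nth_derivative l c I)"
proof (induction l arbitrary: k)
  case (Suc l)
  have "smooth_curve (l + Suc k) I c"
    using Suc.prems by (simp only: add_Suc add_Suc_right)
  then have "smooth_curve (Suc k) I (nth_derivative l c I)" by (rule Suc.IH)
  then obtain c' where c': "\<And>t. t \<in> I \<Longrightarrow>
      (nth_derivative l c I has_vector_derivative c' t) (at t within I)" "smooth_curve k I c'"
    by auto
  then show ?case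
    by (intro smooth_curve_cong[OF _ c'(2)]) (simp add: vector_derivative_within[OF nontriv c'(1)])
qed simp

lemma smooth_curve_imp_C_curve:
  fixes c :: "real \<Rightarrow> 'a::real_normed_vector"
  assumes "is_interval I" "smooth_curve m I c" "l \<le> m"
  shows "times_differentiable_on l c I \<and> continuous_on I (nth_derivative l c I)"
proof (cases "\<exists>t. I \<subseteq> {t}")
  case True
  \<comment> \<open>Within a set of at most one point every function is differentiable, since the filter is
    trivial.\<close>
  then have "at t within I = bot" if "t \<in> I" for t
    using that by (auto simp: subset_singleton_iff at_within_eq_bot_iff)
  then have "b differentiable_on I" for b :: "real \<Rightarrow> 'a"
    by (auto simp: differentiable_on_def differentiable_def has_derivative_def
        intro!: exI[of _ "\<lambda>_. 0"] bounded_linear_zero)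
  then show ?thesis
    using differentiable_imp_continuous_on by (auto simp: times_differentiable_on_def)
next
  case False
  have nontriv: "at t within I \<noteq> bot" if "t \<in> I" for t
    using connected_imp_perfect[of I t] is_interval_connected[OF assms(1)] that False
    by (auto simp: trivial_limit_within)
  have "nth_derivative k c I differentiable_on I" if "k < l" for k
  proof -
    have "smooth_curve (Suc (m - Suc k)) I (nth_derivative k c I)"
      using that assms(2,3) by (intro smooth_curve_nth_derivative[OF nontriv]) auto
    then show ?thesis
      by (auto simp: differentiable_on_def intro: differentiableI_vector)
  qed
  moreover have "continuous_on I (nth_derivative l c I)"
    using assms(2,3) smooth_curve_nth_derivative[OF nontriv, where l = l and k = "m - l"]
    by (auto intro: smooth_curve_continuous)
  ultimately show ?thesis by (simp add: times_differentiable_on_def)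
qed

theorem theorem4p5:
  fixes J1 J2 I :: "real set"
    and f :: "real \<times> real \<Rightarrow> real"
    and S T :: "real \<Rightarrow> complex^'n^'n"
    and m :: nat
  assumes "open J1" "is_interval J1" "open J2" "is_interval J2"
    and "C_two_vars_on m (J1 \<times> J2) f"
    and "is_interval I"
    and "C_curve_on m (\<lambda>t. (S t, T t)) I"
    and "\<And>t. t \<in> I \<Longrightarrow> (S t, T t) \<in> CS2"
    and "\<And>t. t \<in> I \<Longrightarrow> joint_eigenvalues (S t) (T t) \<subseteq> J1 \<times> J2"
  shows "\<forall>l. 1 \<le> l \<and> l \<le> m \<longrightarrow>
    times_differentiable_on l (\<lambda>t. matrix_function f (S t) (T t)) I \<and>
    continuous_on I (nth_derivative l (\<lambda>t. matrix_function f (S t) (T t)) I)"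
proof -
  obtain U x y where diag: "\<And>t. t \<in> I \<Longrightarrow> joint_diagonalization (U t) (x t) (y t) (S t) (T t)"
    using joint_diagonalization_exists[OF assms(8)] by metis
  have U: "unitary (U t)"
    and S: "S t = U t ** diag_matrix (x t) ** conj_transpose (U t)"
    and T: "T t = U t ** diag_matrix (y t) ** conj_transpose (U t)" if "t \<in> I" for t
    using diag[OF that] by (auto simp: joint_diagonalization_def)
  have "(x t i, y t i) \<in> joint_eigenvalues (S t) (T t)" if "t \<in> I" for t i
    unfolding joint_eigenvalues_def using diag[OF that] by blast
  then have eig: "x t i \<in> J1" "y t i \<in> J2" if "t \<in> I" for t i
    using assms(9)[OF that] that by blast+
  have smooth: "smooth_curve m I (\<lambda>t. (S t, T t))"
    using assms(7) by (rule C_curve_on_imp_smooth_curve)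
  have "smooth_curve m I S" "smooth_curve m I T"
    using smooth_curve_bounded_linear[OF bounded_linear_fst smooth]
      smooth_curve_bounded_linear[OF bounded_linear_snd smooth] by simp_all
  \<comment> \<open>Even variables take eigenvalues of \<open>S\<close>, odd variables eigenvalues of \<open>T\<close>.\<close>
  define A where "A k = (if even k then S else T)" for k :: nat
  define e where "e k t = (if even k then x t else y t)" for k :: nat and t
  define J where "J k = (if even k then J1 else J2)" for k :: nat
  define P where "P t = spectral_projection (U t)" for t
  have smooth_A: "smooth_curve m I (A k)" for k
    using \<open>smooth_curve m I S\<close> \<open>smooth_curve m I T\<close> by (simp add: A_def)
  interpret spectral_curves I A P e J
  proof
    fix t i k assume t: "t \<in> I"
    show "(\<Sum>i\<in>UNIV. P t i) = mat 1" "norm (P t i) = 1"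
      using U[OF t] by (simp_all add: P_def sum_spectral_projection norm_spectral_projection)
    show "P t i ** A k t = e k t i *\<^sub>R P t i" "A k t ** P t i = e k t i *\<^sub>R P t i"
      using U[OF t] S[OF t] T[OF t]
      by (simp_all add: P_def A_def e_def spectral_projection_mult_diagonalization
          diagonalization_mult_spectral_projection)
    show "e k t i \<in> J k" using eig[OF t] by (simp add: e_def J_def)
  next
    fix k N :: nat
    show "open (J k)" "convex (J k)"
      using assms(1-4) by (simp_all add: J_def is_interval_convex)
    show "continuous_on I (A k)" using smooth_A by (rule smooth_curve_continuous)
    \<comment> \<open>\<open>2 * N + k\<close> has the parity of \<open>k\<close>.\<close>
    show "\<exists>d\<ge>N. A d = A k \<and> e d = e k \<and> J d = J k"
      by (intro exI[of _ "2 * N + k"]) (simp add: A_def e_def J_def fun_eq_iff)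
  qed
  let ?g = "\<lambda>z :: nat \<Rightarrow> real. f (z 0, z (Suc 0))"
  let ?w = "[(\<lambda>t :: real. mat 1 :: complex^'n^'n, 0), (\<lambda>t. mat 1, Suc 0)]"
  have "admissible m 2 ?g ?w"
    using C_two_vars_on_imp_smooth_on_box[OF assms(5), of J]
    by (auto simp: admissible_def J_def independent_of_def smooth_curve_const)
  note smooth_integral = curve_integral_smooth[OF smooth_A this]
  have F: "curve_integral ?g z ?w t = matrix_function f (S t) (T t)" if t: "t \<in> I" for z t
  proof -
    have "curve_integral ?g z ?w t
        = (\<Sum>i\<in>UNIV. \<Sum>j\<in>UNIV. f (x t i, y t j) *\<^sub>R (P t i ** P t j))"
      by (simp add: curve_integral_Cons curve_integral_Nil e_def matmul.sum_right
          matmul.scaleR_right)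
    also have "\<dots> = (\<Sum>i\<in>UNIV. f (x t i, y t i) *\<^sub>R P t i)"
      by (simp add: P_def spectral_projection_mult[OF U[OF t]] if_distrib cong: if_cong)
    also have "\<dots> = matrix_function f (S t) (T t)"
      by (simp add: matrix_function_eq[OF diag[OF t]] diagonalization_eq_sum P_def)
    finally show ?thesis .
  qed
  have "smooth_curve m I (\<lambda>t. matrix_function f (S t) (T t))"
  proof (cases "I = {}")
    case False
    then obtain t where "t \<in> I" by blast
    then have "(\<lambda>k. e k t undefined) \<in> Pi UNIV J" by (auto intro: e_in_J)
    from smooth_curve_cong[OF F smooth_integral[OF this]] show ?thesis by simp
  next
    case True
    show ?thesis unfolding True by (induction m) auto
  qed
  then show ?thesis
    using smooth_curve_imp_C_curve[OF assms(6)] by blast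
qed

end
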